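(* For all $m,n\ge 1$ there are homeomorphisms \[ \mathrm{Rep}(\mathbb{Z}^{n},U(m))\cong SP^{m}((\mathbb{S}^{1})^{n}),\qquad \mathrm{Rep}(\mathbb{Z}^{n},Sp(m))\cong SP^{m}\big((\mathbb{S}^{1})^{n}/(\mathbb{Z}/2)\big), \] where $\mathbb{Z}/2$ acts diagonally by complex conjugation on each factor. Moreover, for each $m,n\ge 1$ the determinant map defines a locally trivial bundle \[ \mathrm{Rep}(\mathbb{Z}^{n},SU(m))\to \mathrm{Rep}(\mathbb{Z}^{n},U(m))\to(\mathbb{S}^{1})^{n}. \]
   Context: For a Lie group $G$, $\mathrm{Hom}(\mathbb{Z}^{n},G)\subset G^n$ is the space of commuting $n$-tuples and $\mathrm{Rep}(\mathbb{Z}^{n},G)=\mathrm{Hom}(\mathbb{Z}^{n},G)/G$ its orbit space under simultaneous conjugation. $SP^m(X)=X^m/\Sigma_m$ is the $m$-th symmetric product. In the bundle, the first map (inclusion of the fiber) is induced by the inclusion $SU(m)\subset U(m)$ and the second is $[A_1,\dots,A_n]\mapsto(\det A_1,\dots,\det A_n)$. *)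

theory Defs
  imports "HOL-Analysis.Analysis"
begin

text \<open>A group acting on a space is represented by the set \<open>\<Gamma>\<close> of self-maps by which its
  elements act; the points of the orbit space are the orbits themselves.\<close>

definition orbit :: "('a \<Rightarrow> 'a) set \<Rightarrow> 'a \<Rightarrow> 'a set" where
  "orbit \<Gamma> x = (\<lambda>g. g x) ` \<Gamma>"

definition orbit_space :: "'a topology \<Rightarrow> ('a \<Rightarrow> 'a) set \<Rightarrow> 'a set topology" where
  "orbit_space X \<Gamma> =
     topology (\<lambda>V. V \<subseteq> orbit \<Gamma> ` topspace X \<and> openin X {x \<in> topspace X. orbit \<Gamma> x \<in> V})"

lemma openin_orbit_space:
  "openin (orbit_space X \<Gamma>) V \<longleftrightarrow>
     V \<subseteq> orbit \<Gamma> ` topspace X \<and> openin X {x \<in> topspace X. orbit \<Gamma> x \<in> V}"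
proof -
  have "istopology (\<lambda>V. V \<subseteq> orbit \<Gamma> ` topspace X \<and> openin X {x \<in> topspace X. orbit \<Gamma> x \<in> V})"
    unfolding istopology_def
  proof (intro conjI allI impI)
    fix S T
    assume S: "S \<subseteq> orbit \<Gamma> ` topspace X \<and> openin X {x \<in> topspace X. orbit \<Gamma> x \<in> S}"
      and T: "T \<subseteq> orbit \<Gamma> ` topspace X \<and> openin X {x \<in> topspace X. orbit \<Gamma> x \<in> T}"
    have "{x \<in> topspace X. orbit \<Gamma> x \<in> S \<inter> T} =
      {x \<in> topspace X. orbit \<Gamma> x \<in> S} \<inter> {x \<in> topspace X. orbit \<Gamma> x \<in> T}" by auto
    with S T show "openin X {x \<in> topspace X. orbit \<Gamma> x \<in> S \<inter> T}"
      by (metis (no_types, lifting) openin_Int)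
    show "S \<inter> T \<subseteq> orbit \<Gamma> ` topspace X" using S by blast
  next
    fix \<K>
    assume K: "\<forall>K\<in>\<K>. K \<subseteq> orbit \<Gamma> ` topspace X \<and> openin X {x \<in> topspace X. orbit \<Gamma> x \<in> K}"
    have "{x \<in> topspace X. orbit \<Gamma> x \<in> \<Union>\<K>} = (\<Union>K\<in>\<K>. {x \<in> topspace X. orbit \<Gamma> x \<in> K})" by auto
    with K show "openin X {x \<in> topspace X. orbit \<Gamma> x \<in> \<Union>\<K>}"
      by (metis (no_types, lifting) openin_clauses(3) image_iff)
    show "\<Union>\<K> \<subseteq> orbit \<Gamma> ` topspace X" using K by blast
  qed
  then show ?thesis unfolding orbit_space_def by (simp add: topology_inverse')
qed

lemma topspace_orbit_space: "topspace (orbit_space X \<Gamma>) = orbit \<Gamma> ` topspace X"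
proof
  show "topspace (orbit_space X \<Gamma>) \<subseteq> orbit \<Gamma> ` topspace X"
    using openin_topspace[of "orbit_space X \<Gamma>"] unfolding openin_orbit_space by blast
  have "{x \<in> topspace X. orbit \<Gamma> x \<in> orbit \<Gamma> ` topspace X} = topspace X" by auto
  then have "openin (orbit_space X \<Gamma>) (orbit \<Gamma> ` topspace X)"
    unfolding openin_orbit_space by simp
  then show "orbit \<Gamma> ` topspace X \<subseteq> topspace (orbit_space X \<Gamma>)" by (rule openin_subset)
qed

lemma quotient_map_orbit: "quotient_map X (orbit_space X \<Gamma>) (orbit \<Gamma>)"
  unfolding quotient_map_def topspace_orbit_space openin_orbit_space by auto

text \<open>The map of orbits induced by a map \<open>f\<close> that is constant on orbits.\<close>

definition orbit_lift :: "('a \<Rightarrow> 'b) \<Rightarrow> 'a set \<Rightarrow> 'b" where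
  "orbit_lift f c = the_elem (f ` c)"

lemma orbit_lift_orbit:
  assumes "\<Gamma> \<noteq> {}" and "\<And>g. g \<in> \<Gamma> \<Longrightarrow> f (g x) = f x"
  shows "orbit_lift f (orbit \<Gamma> x) = f x"
proof -
  have "f ` orbit \<Gamma> x = {f x}" using assms by (auto simp: orbit_def image_image)
  then show ?thesis by (simp add: orbit_lift_def)
qed

definition conj_transpose :: "complex^'k^'k \<Rightarrow> complex^'k^'k" where
  "conj_transpose A = (\<chi> i j. cnj (A $ j $ i))"

definition unitary_group :: "(complex^'k^'k) set" where
  "unitary_group = {A. conj_transpose A ** A = mat 1 \<and> A ** conj_transpose A = mat 1}"

definition special_unitary_group :: "(complex^'k^'k) set" where
  "special_unitary_group = {A \<in> unitary_group. det A = 1}"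

text \<open>The matrix of the standard symplectic form on \<open>\<complex>\<^sup>m \<oplus> \<complex>\<^sup>m\<close>, the two summands being
  indexed by \<open>Inl\<close> and \<open>Inr\<close>.\<close>

definition symplectic_J :: "complex^('k::finite + 'k)^('k + 'k)" where
  "symplectic_J = (\<chi> i j. case (i, j) of
      (Inl a, Inr b) \<Rightarrow> (if a = b then 1 else 0)
    | (Inr a, Inl b) \<Rightarrow> (if a = b then - 1 else 0)
    | _ \<Rightarrow> 0)"

text \<open>The compact group \<open>Sp(m) = U(2m) \<inter> Sp(2m, \<complex>)\<close>, i.e. the isometries of quaternionic
  \<open>m\<close>-space written as complex matrices of size \<open>2m\<close>.\<close>

definition compact_symplectic_group :: "(complex^('k::finite + 'k)^('k + 'k)) set" where
  "compact_symplectic_group =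
     {A \<in> unitary_group. transpose A ** symplectic_J ** A = symplectic_J}"

definition commuting_tuples :: "(complex^'k^'k) set \<Rightarrow> ((complex^'k^'k)^'n) set" where
  "commuting_tuples G = {A. (\<forall>i. A $ i \<in> G) \<and> (\<forall>i j. A $ i ** A $ j = A $ j ** A $ i)}"

definition conjugate_tuple :: "complex^'k^'k \<Rightarrow> (complex^'k^'k)^'n \<Rightarrow> (complex^'k^'k)^'n" where
  "conjugate_tuple g A = (\<chi> i. g ** A $ i ** matrix_inv g)"

definition Hom_space :: "(complex^'k^'k) set \<Rightarrow> ((complex^'k^'k)^'n) topology" where
  "Hom_space G = top_of_set (commuting_tuples G)"

definition Rep_space :: "(complex^'k^'k) set \<Rightarrow> ((complex^'k^'k)^'n) set topology" where
  "Rep_space G = orbit_space (Hom_space G) (conjugate_tuple ` G)"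

definition det_tuple :: "(complex^'k^'k)^'n \<Rightarrow> complex^'n" where
  "det_tuple A = (\<chi> i. det (A $ i))"

definition Rep_det :: "((complex^'k^'k)^'n) set \<Rightarrow> complex^'n" where
  "Rep_det = orbit_lift det_tuple"

text \<open>The map \<open>Rep(\<int>\<^sup>n, H) \<rightarrow> Rep(\<int>\<^sup>n, G)\<close> induced by an inclusion \<open>H \<subseteq> G\<close>; it depends
  on \<open>G\<close> only.\<close>

definition Rep_incl ::
    "(complex^'k^'k) set \<Rightarrow> ((complex^'k^'k)^'n) set \<Rightarrow> ((complex^'k^'k)^'n) set" where
  "Rep_incl G = orbit_lift (orbit (conjugate_tuple ` G))"

definition torus :: "(complex^'n) topology" where
  "torus = top_of_set {z. \<forall>i. z $ i \<in> sphere 0 1}"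

definition torus_mod_conj :: "(complex^'n) set topology" where
  "torus_mod_conj = orbit_space torus {id, \<lambda>z. \<chi> i. cnj (z $ i)}"

text \<open>\<open>SP\<^sup>m(X)\<close>, where \<open>m\<close> is the cardinality of the index type \<open>'m\<close>.\<close>

definition symmetric_product :: "'a topology \<Rightarrow> ('m::finite \<Rightarrow> 'a) set topology" where
  "symmetric_product X =
     orbit_space (product_topology (\<lambda>_. X) UNIV) ((\<lambda>p x. x \<circ> p) ` {p. bij p})"

text \<open>\<open>F \<rightarrow> E \<rightarrow> B\<close> is a locally trivial bundle with fibre \<open>F\<close>, included by \<open>i\<close> as the fibre
  over the base point \<open>b\<^sub>0\<close>.\<close>

definition locally_trivial_bundle ::
    "'f topology \<Rightarrow> ('f \<Rightarrow> 'e) \<Rightarrow> 'e topology \<Rightarrow> ('e \<Rightarrow> 'b) \<Rightarrow> 'b topology \<Rightarrow> 'b \<Rightarrow> bool" where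
  "locally_trivial_bundle F i E p B b\<^sub>0 \<longleftrightarrow>
     continuous_map E B p \<and> p ` topspace E = topspace B \<and>
     b\<^sub>0 \<in> topspace B \<and>
     homeomorphic_map F (subtopology E {x \<in> topspace E. p x = b\<^sub>0}) i \<and>
     (\<forall>b \<in> topspace B. \<exists>U h. openin B U \<and> b \<in> U \<and>
        homeomorphic_map (subtopology E {x \<in> topspace E. p x \<in> U})
          (prod_topology (subtopology B U) F) h \<and>
        (\<forall>x \<in> topspace E. p x \<in> U \<longrightarrow> fst (h x) = p x))"

lemma conj_transpose_mult: "conj_transpose (A ** B) = conj_transpose B ** conj_transpose A"
  by (simp add: conj_transpose_def matrix_matrix_mult_def vec_eq_iff mult.commute)

lemma conj_transpose_mat_1 [simp]: "conj_transpose (mat 1) = mat 1"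
  by (simp add: conj_transpose_def mat_def vec_eq_iff)

lemma mat_1_in_unitary_group: "mat 1 \<in> unitary_group"
  by (simp add: unitary_group_def)

lemma matrix_inv_unitary:
  assumes "g \<in> unitary_group"
  shows "matrix_inv g = conj_transpose g"
proof -
  have g: "conj_transpose g ** g = mat 1" "g ** conj_transpose g = mat 1"
    using assms by (auto simp: unitary_group_def)
  then have "\<exists>B. g ** B = mat 1 \<and> B ** g = mat 1" by blast
  then have "g ** matrix_inv g = mat 1 \<and> matrix_inv g ** g = mat 1"
    unfolding matrix_inv_def by (rule someI_ex)
  with g show ?thesis by (metis matrix_mul_assoc matrix_mul_lid matrix_mul_rid)
qed

lemma unitary_group_mult:
  assumes "g \<in> unitary_group" "h \<in> unitary_group"
  shows "g ** h \<in> unitary_group"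
proof -
  have g: "conj_transpose g ** g = mat 1" "g ** conj_transpose g = mat 1"
    and h: "conj_transpose h ** h = mat 1" "h ** conj_transpose h = mat 1"
    using assms by (auto simp: unitary_group_def)
  have "conj_transpose h ** conj_transpose g ** (g ** h) =
      conj_transpose h ** (conj_transpose g ** g) ** h"
    by (simp only: matrix_mul_assoc)
  moreover have "g ** h ** (conj_transpose h ** conj_transpose g) =
      g ** (h ** conj_transpose h) ** conj_transpose g"
    by (simp only: matrix_mul_assoc)
  ultimately show ?thesis
    using g h by (simp add: unitary_group_def conj_transpose_mult)
qed

lemma unitary_group_conj_transpose:
  "g \<in> unitary_group \<Longrightarrow> conj_transpose g \<in> unitary_group"
  by (simp add: unitary_group_def conj_transpose_def)

lemma det_tuple_conjugate:
  assumes "g \<in> unitary_group"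
  shows "det_tuple (conjugate_tuple g A) = det_tuple A"
proof -
  have "det g * det (conj_transpose g) = 1"
    using assms by (simp add: unitary_group_def flip: det_mul)
  then show ?thesis
    unfolding det_tuple_def conjugate_tuple_def
    by (simp add: det_mul matrix_inv_unitary[OF assms] vec_eq_iff mult.commute)
qed

lemma conjugate_tuple_mult:
  assumes "g \<in> unitary_group" "h \<in> unitary_group"
  shows "conjugate_tuple g (conjugate_tuple h A) = conjugate_tuple (g ** h) A"
  using assms
  by (simp add: conjugate_tuple_def matrix_inv_unitary unitary_group_mult conj_transpose_mult
      matrix_mul_assoc)

lemma orbit_conjugate_tuple:
  assumes h: "h \<in> unitary_group"
  shows "orbit (conjugate_tuple ` unitary_group) (conjugate_tuple h A) =
         orbit (conjugate_tuple ` unitary_group) A"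
proof -
  have "g \<in> (\<lambda>k. k ** h) ` unitary_group" if g: "g \<in> unitary_group" for g
  proof (rule image_eqI)
    show "g = g ** conj_transpose h ** h"
      using h by (simp add: matrix_mul_assoc[symmetric] unitary_group_def)
    show "g ** conj_transpose h \<in> unitary_group"
      using g h by (simp add: unitary_group_mult unitary_group_conj_transpose)
  qed
  then have "(\<lambda>k. k ** h) ` unitary_group = unitary_group"
    using h by (auto simp: unitary_group_mult)
  moreover have "orbit (conjugate_tuple ` unitary_group) (conjugate_tuple h A) =
      (\<lambda>k. conjugate_tuple k A) ` ((\<lambda>k. k ** h) ` unitary_group)"
    using h by (auto simp: orbit_def image_image conjugate_tuple_mult)
  ultimately show ?thesis by (simp add: orbit_def image_image)
qed

lemma Rep_det_orbit:
  "Rep_det (orbit (conjugate_tuple ` unitary_group) A) = det_tuple A"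
  unfolding Rep_det_def using mat_1_in_unitary_group
  by (intro orbit_lift_orbit) (auto simp: det_tuple_conjugate)

lemma Rep_incl_orbit:
  "Rep_incl unitary_group (orbit (conjugate_tuple ` special_unitary_group) A) =
   orbit (conjugate_tuple ` unitary_group) A"
proof -
  have "mat 1 \<in> special_unitary_group"
    by (simp add: special_unitary_group_def mat_1_in_unitary_group)
  then show ?thesis
    unfolding Rep_incl_def
    by (intro orbit_lift_orbit) (auto simp: orbit_conjugate_tuple special_unitary_group_def)
qed

end

theory Submission
  imports Defs "HOL-Computational_Algebra.Fundamental_Theorem_Algebra"
begin

text \<open>Commuting tuples in \<open>U(m)\<close> and \<open>Sp(m)\<close> can be diagonalised simultaneously by an element of the
  group, so the torus power \<open>((S\<^sup>1)\<^sup>n)\<^sup>m\<close> maps onto the representation space. Traces of products of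
  factors \<open>A\<^sub>k - u\<close> are continuous conjugation invariants. On diagonal tuples they determine the
  multiset of joint eigenvalues; hence the representation space is Hausdorff, the fibres of the
  map are those of the quotient map to the symmetric product, and compactness gives the
  homeomorphism.

  Since every unitary matrix is a scalar multiple of a special unitary one, both groups induce the
  same conjugation maps, so \<open>Rep(\<int>\<^sup>n, SU(m))\<close> is literally the fibre of the determinant. The torus acts
  on \<open>Rep(\<int>\<^sup>n, U(m))\<close> by scaling, which changes the determinant by an \<open>m\<close>-th power; local
  \<open>m\<close>-th roots on the base therefore give local trivialisations.\<close>

subsection \<open>Orbit spaces and tori\<close>

text \<open>Diagonal tuples give a continuous bijection from the compact symmetric product onto Rep;
  this is a homeomorphism once Rep is known to be Hausdorff, and the same continuous invariants
  settle both that and injectivity. Traces of polynomials in a single \<open>A $ k\<close> would see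
  each spectrum separately but not which eigenvalues belong to the same joint eigenvector, so the
  words mix different indices. For Sp(m) the antilinear structure map sends an eigenvector to one
  with the conjugate eigenvalue. Traces therefore see joint eigenvalues only in conjugate pairs, and
  those fixed by conjugation occur with even multiplicity; halving the count there recovers the
  point of the symmetric product of the quotient torus. For the bundle, the power map t -> t^m of
  the torus has no global continuous section when m > 1, so the scaling action trivialises only
  locally.\<close>

lemma homeomorphic_space_of_quotient:
  assumes K: "compact_space K" and q: "quotient_map K Q q"
    and r: "continuous_map K Z r" and onto: "r ` topspace K = topspace Z"
    and Z: "Hausdorff_space Z"
    and fib: "\<And>x y. \<lbrakk>x \<in> topspace K; y \<in> topspace K\<rbrakk> \<Longrightarrow> q x = q y \<longleftrightarrow> r x = r y"
  shows "Z homeomorphic_space Q"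
proof -
  obtain g where g: "continuous_map Q Z g" "g ` topspace Q = r ` topspace K"
      "\<And>x. x \<in> topspace K \<Longrightarrow> g (q x) = r x"
    using quotient_map_lift_exists[OF q r] fib by metis
  have Q: "topspace Q = q ` topspace K"
    using quotient_imp_surjective_map[OF q] by simp
  have "compact_space Q"
    using image_compactin[of K "topspace K" Q q] K q Q
    by (simp add: compact_space_def quotient_imp_continuous_map)
  moreover have "inj_on g (topspace Q)"
    unfolding Q by (rule inj_onI) (use g(3) fib in auto)
  ultimately have "homeomorphic_map Q Z g"
    using g Z onto by (intro continuous_imp_homeomorphic_map) auto
  then show ?thesis
    using homeomorphic_map_imp_homeomorphic_space homeomorphic_space_sym by blast
qed

lemma Hausdorff_space_by_functions:
  assumes cont: "\<And>f. f \<in> F \<Longrightarrow> continuous_map Z (euclidean :: 'b::t2_space topology) f"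
    and sep: "\<And>x y. \<lbrakk>x \<in> topspace Z; y \<in> topspace Z; x \<noteq> y\<rbrakk> \<Longrightarrow> \<exists>f\<in>F. f x \<noteq> f y"
  shows "Hausdorff_space Z"
  unfolding Hausdorff_space_def
proof (intro allI impI)
  fix x y assume xy: "x \<in> topspace Z \<and> y \<in> topspace Z \<and> x \<noteq> y"
  then obtain f where f: "f \<in> F" "f x \<noteq> f y" using sep by blast
  then obtain U V where UV: "open U" "open V" "f x \<in> U" "f y \<in> V" "U \<inter> V = {}"
    using hausdorff by metis
  let ?P = "\<lambda>W. {z \<in> topspace Z. f z \<in> W}"
  have "openin Z (?P U)" "openin Z (?P V)"
    using cont[OF f(1)] UV by (auto simp: continuous_map_def)
  then show "\<exists>U V. openin Z U \<and> openin Z V \<and> x \<in> U \<and> y \<in> V \<and> disjnt U V"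
    using UV xy by (intro exI[of _ "?P U"] exI[of _ "?P V"] conjI) (auto simp: disjnt_def)
qed

text \<open>Each invariant function descends along the quotient map, and the descended functions
  separate points. This takes the place of an argument from compactness of the acting group.\<close>

lemma Hausdorff_orbit_space:
  assumes cont: "\<And>f. f \<in> F \<Longrightarrow> continuous_map X (euclidean :: 'b::t2_space topology) f"
    and inv: "\<And>f x y. \<lbrakk>f \<in> F; x \<in> topspace X; y \<in> topspace X; orbit \<Gamma> x = orbit \<Gamma> y\<rbrakk> \<Longrightarrow> f x = f y"
    and sep: "\<And>x y. \<lbrakk>x \<in> topspace X; y \<in> topspace X; \<forall>f\<in>F. f x = f y\<rbrakk> \<Longrightarrow> orbit \<Gamma> x = orbit \<Gamma> y"
  shows "Hausdorff_space (orbit_space X \<Gamma>)"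
proof -
  have "\<exists>g. continuous_map (orbit_space X \<Gamma>) euclidean g \<and> (\<forall>x\<in>topspace X. g (orbit \<Gamma> x) = f x)"
    if f: "f \<in> F" for f
  proof -
    obtain g where "continuous_map (orbit_space X \<Gamma>) euclidean g"
      "\<And>x. x \<in> topspace X \<Longrightarrow> g (orbit \<Gamma> x) = f x"
      by (rule quotient_map_lift_exists[OF quotient_map_orbit[of X \<Gamma>] cont[OF f]])
        (rule inv[OF f], assumption+, rule that)
    then show ?thesis by blast
  qed
  then obtain h where h: "\<And>f. f \<in> F \<Longrightarrow> continuous_map (orbit_space X \<Gamma>) euclidean (h f)"
    "\<And>f x. \<lbrakk>f \<in> F; x \<in> topspace X\<rbrakk> \<Longrightarrow> h f (orbit \<Gamma> x) = f x"
    by metis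
  show ?thesis
  proof (rule Hausdorff_space_by_functions[where F = "h ` F"])
    fix c d assume cd: "c \<in> topspace (orbit_space X \<Gamma>)" "d \<in> topspace (orbit_space X \<Gamma>)" "c \<noteq> d"
    then obtain x y where xy: "x \<in> topspace X" "y \<in> topspace X" "c = orbit \<Gamma> x" "d = orbit \<Gamma> y"
      unfolding topspace_orbit_space by blast
    then obtain f where f: "f \<in> F" "f x \<noteq> f y" using sep[OF xy(1,2)] cd(3) by blast
    then have "h f c \<noteq> h f d" using h(2)[OF f(1) xy(1)] h(2)[OF f(1) xy(2)] xy(3,4) by simp
    then show "\<exists>g\<in>h ` F. g c \<noteq> g d" using f(1) by blast
  qed (use h in auto)
qed

text \<open>Common core of the unitary and symplectic cases: \<open>K\<close> is the torus power,
  \<open>q\<close> its map to the symmetric product, \<open>\<phi>\<close> forms diagonal tuples and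
  \<open>F\<close> consists of the word traces. The assumptions \<open>fib\<close>,
  \<open>inv\<close> and \<open>sep\<close> close a circle, so that equality under \<open>q\<close>,
  equality of orbits and equality of all invariants agree on \<open>K\<close>.\<close>

lemma orbit_space_homeomorphic_quotient:
  assumes K: "compact_space K" and q: "quotient_map K Q q"
    and \<phi>: "continuous_map K X \<phi>"
    and onto: "\<And>x. x \<in> topspace X \<Longrightarrow> \<exists>k\<in>topspace K. orbit \<Gamma> (\<phi> k) = orbit \<Gamma> x"
    and fib: "\<And>k l. \<lbrakk>k \<in> topspace K; l \<in> topspace K; q k = q l\<rbrakk> \<Longrightarrow> orbit \<Gamma> (\<phi> k) = orbit \<Gamma> (\<phi> l)"
    and cont: "\<And>f. f \<in> F \<Longrightarrow> continuous_map X (euclidean :: 'b::t2_space topology) f"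
    and inv: "\<And>f x y. \<lbrakk>f \<in> F; x \<in> topspace X; y \<in> topspace X; orbit \<Gamma> x = orbit \<Gamma> y\<rbrakk> \<Longrightarrow> f x = f y"
    and sep: "\<And>k l. \<lbrakk>k \<in> topspace K; l \<in> topspace K; \<forall>f\<in>F. f (\<phi> k) = f (\<phi> l)\<rbrakk> \<Longrightarrow> q k = q l"
  shows "orbit_space X \<Gamma> homeomorphic_space Q"
proof (rule homeomorphic_space_of_quotient[OF K q])
  have \<phi>X: "\<phi> k \<in> topspace X" if "k \<in> topspace K" for k
    using \<phi> that by (auto simp: continuous_map_def)
  show "continuous_map K (orbit_space X \<Gamma>) (orbit \<Gamma> \<circ> \<phi>)"
    using \<phi> quotient_imp_continuous_map[OF quotient_map_orbit] by (rule continuous_map_compose)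
  show "(orbit \<Gamma> \<circ> \<phi>) ` topspace K = topspace (orbit_space X \<Gamma>)"
    unfolding topspace_orbit_space
  proof (intro equalityI subsetI)
    fix c assume "c \<in> orbit \<Gamma> ` topspace X"
    then obtain x where x: "x \<in> topspace X" "c = orbit \<Gamma> x" by blast
    then obtain k where "k \<in> topspace K" "orbit \<Gamma> (\<phi> k) = c" using onto by blast
    then show "c \<in> (orbit \<Gamma> \<circ> \<phi>) ` topspace K" by auto
  qed (use \<phi>X in auto)
  show "Hausdorff_space (orbit_space X \<Gamma>)"
  proof (rule Hausdorff_orbit_space[OF cont inv])
    fix x y assume xy: "x \<in> topspace X" "y \<in> topspace X" "\<forall>f\<in>F. f x = f y"
    obtain k where k: "k \<in> topspace K" "orbit \<Gamma> (\<phi> k) = orbit \<Gamma> x" using onto xy(1) by blast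
    obtain l where l: "l \<in> topspace K" "orbit \<Gamma> (\<phi> l) = orbit \<Gamma> y" using onto xy(2) by blast
    have "f (\<phi> k) = f (\<phi> l)" if "f \<in> F" for f
      using inv[OF that \<phi>X[OF k(1)] xy(1) k(2)] inv[OF that \<phi>X[OF l(1)] xy(2) l(2)]
        bspec[OF xy(3) that] by (simp only:)
    then have "orbit \<Gamma> (\<phi> k) = orbit \<Gamma> (\<phi> l)"
      using fib[OF k(1) l(1) sep[OF k(1) l(1)]] by blast
    then show "orbit \<Gamma> x = orbit \<Gamma> y" using k l by simp
  qed
  show "q k = q l \<longleftrightarrow> (orbit \<Gamma> \<circ> \<phi>) k = (orbit \<Gamma> \<circ> \<phi>) l"
    if "k \<in> topspace K" "l \<in> topspace K" for k l
  proof
    assume "(orbit \<Gamma> \<circ> \<phi>) k = (orbit \<Gamma> \<circ> \<phi>) l"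
    then have "orbit \<Gamma> (\<phi> k) = orbit \<Gamma> (\<phi> l)" by simp
    then have "\<forall>f\<in>F. f (\<phi> k) = f (\<phi> l)"
      using inv[OF _ \<phi>X[OF that(1)] \<phi>X[OF that(2)]] by blast
    then show "q k = q l" using sep[OF that] by blast
  qed (simp add: fib[OF that])
qed

text \<open>Serves to identify the subspace topology on the fibre of the determinant with the
  quotient topology on Rep of SU(m): both are quotients along the same orbit map.\<close>

lemma quotient_topology_unique:
  assumes "quotient_map X Y f" "quotient_map X Z f"
  shows "Y = Z"
  unfolding topology_eq
proof
  fix S
  have *: "topspace Y = topspace Z" using assms by (metis quotient_imp_surjective_map)
  show "openin Y S = openin Z S"
  proof (cases "S \<subseteq> topspace Y")
    case True
    then show ?thesis using assms * unfolding quotient_map_def by simp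
  next
    case False
    then show ?thesis using * openin_subset by metis
  qed
qed

lemma exists_reindexing:
  fixes x y :: "'m::finite \<Rightarrow> 'a"
  assumes "\<And>v. card {j. x j = v} = card {j. y j = v}"
  obtains p where "bij p" "x = y \<circ> p"
proof -
  have "image_mset x (mset_set UNIV) = image_mset y (mset_set UNIV)"
    by (rule multiset_eqI) (use assms in \<open>simp add: count_image_mset vimage_def\<close>)
  then obtain p where "p permutes UNIV" "\<forall>j\<in>UNIV. x j = y (p j)"
    using image_mset_eq_implies_permutes[OF finite] by metis
  then show thesis using that[of p] by (auto simp: permutes_bij fun_eq_iff)
qed

lemma orbit_reindexing:
  "orbit ((\<lambda>p x. x \<circ> p) ` {p. bij p}) x = {x \<circ> p |p. bij p}"
  by (auto simp: orbit_def)

lemma orbit_reindexing_eq_iff: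
  fixes x y :: "'m::finite \<Rightarrow> 'a"
  shows "orbit ((\<lambda>p x. x \<circ> p) ` {p. bij p}) x = orbit ((\<lambda>p x. x \<circ> p) ` {p. bij p}) y
     \<longleftrightarrow> (\<exists>p. bij p \<and> x = y \<circ> p)"
proof
  assume "orbit ((\<lambda>p x. x \<circ> p) ` {p. bij p}) x = orbit ((\<lambda>p x. x \<circ> p) ` {p. bij p}) y"
  moreover have "x \<in> orbit ((\<lambda>p x. x \<circ> p) ` {p. bij p}) x"
    unfolding orbit_reindexing by (auto intro: exI[of _ id])
  ultimately show "\<exists>p. bij p \<and> x = y \<circ> p" unfolding orbit_reindexing by auto
next
  assume "\<exists>p. bij p \<and> x = y \<circ> p"
  then obtain p where p: "bij p" "x = y \<circ> p" by blast
  then have y: "y = x \<circ> inv p" by (simp add: fun_eq_iff bij_is_surj surj_f_inv_f)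
  have "\<exists>r. x \<circ> q = y \<circ> r \<and> bij r" "\<exists>r. y \<circ> q = x \<circ> r \<and> bij r" if "bij q" for q
    using p(1,2) y that by (metis bij_comp comp_assoc, metis bij_comp bij_imp_bij_inv comp_assoc)
  then show "orbit ((\<lambda>p x. x \<circ> p) ` {p. bij p}) x = orbit ((\<lambda>p x. x \<circ> p) ` {p. bij p}) y"
    unfolding orbit_reindexing by blast
qed

section \<open>The torus and its quotient by complex conjugation\<close>

lemma compact_space_torus: "compact_space torus"
proof -
  have "norm z \<le> CARD('n)" if "\<forall>i. norm (z $ i) = 1" for z :: "complex^'n"
    unfolding norm_vec_def using L2_set_le_sum[of UNIV "\<lambda>i. norm (z $ i)"] that by simp
  then have "bounded {z :: complex^'n. \<forall>i. z $ i \<in> sphere 0 1}"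
    by (auto simp: bounded_iff)
  moreover have "closed {z :: complex^'n. \<forall>i. z $ i \<in> sphere 0 1}"
    by (auto simp: intro!: closed_Collect_all closed_Collect_eq continuous_intros)
  ultimately show ?thesis
    unfolding torus_def
    by (intro compact_space_subtopology) (simp only: compactin_euclidean_iff compact_eq_bounded_closed)
qed

lemma topspace_torus: "z \<in> topspace torus \<longleftrightarrow> (\<forall>i. norm (z $ i) = 1)"
  by (simp add: torus_def)

lemma Hausdorff_space_torus: "Hausdorff_space torus"
  by (simp add: torus_def Hausdorff_space_subtopology)

definition cnj_vec :: "complex^'n \<Rightarrow> complex^'n" where
  "cnj_vec z = (\<chi> i. cnj (z $ i))"

lemma cnj_vec_cnj_vec [simp]: "cnj_vec (cnj_vec z) = z"
  by (simp add: cnj_vec_def vec_eq_iff)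

lemma cnj_vec_nth [simp]: "cnj_vec z $ i = cnj (z $ i)"
  by (simp add: cnj_vec_def)

lemma orbit_cnj: "orbit {id, \<lambda>z. \<chi> i. cnj (z $ i)} z = {z, cnj_vec z}"
  by (simp add: orbit_def cnj_vec_def)

lemma orbit_cnj_eq_iff:
  "orbit {id, \<lambda>z. \<chi> i. cnj (z $ i)} z = orbit {id, \<lambda>z. \<chi> i. cnj (z $ i)} w
     \<longleftrightarrow> z = w \<or> z = cnj_vec w"
  unfolding orbit_cnj by (metis cnj_vec_cnj_vec doubleton_eq_iff)

text \<open>Two vectors agree up to complex conjugation iff the real parts of their entries and all
  products of two imaginary parts agree.\<close>

lemma Hausdorff_space_torus_mod_conj: "Hausdorff_space (torus_mod_conj :: (complex^'n) set topology)"
  unfolding torus_mod_conj_def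
proof (rule Hausdorff_orbit_space)
  let ?F = "range (\<lambda>k z :: complex^'n. Re (z $ k)) \<union>
    range (\<lambda>(k, l) z. Im (z $ k) * Im (z $ l))"
  show "continuous_map torus euclidean f" if "f \<in> ?F" for f
    using that unfolding torus_def by (auto intro!: continuous_intros)
  show "f x = f y" if "f \<in> ?F"
    "orbit {id, \<lambda>z. \<chi> i. cnj (z $ i)} x = orbit {id, \<lambda>z. \<chi> i. cnj (z $ i)} y" for f x y
    using that unfolding orbit_cnj_eq_iff by (auto simp: cnj_vec_def)
  fix x y :: "complex^'n"
  assume "\<forall>f\<in>?F. f x = f y"
  then have re: "\<And>k. Re (x $ k) = Re (y $ k)"
    and im: "\<And>k l. Im (x $ k) * Im (x $ l) = Im (y $ k) * Im (y $ l)"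
    by (auto simp: ball_Un)
  show "orbit {id, \<lambda>z. \<chi> i. cnj (z $ i)} x = orbit {id, \<lambda>z. \<chi> i. cnj (z $ i)} y"
    unfolding orbit_cnj_eq_iff
  proof (cases "\<exists>k. Im (x $ k) \<noteq> 0")
    case True
    \<comment> \<open>One nonreal coordinate fixes a sign, which decides between the two
      alternatives; the products with index \<open>k\<close> carry that sign to every other
      coordinate.\<close>
    then obtain k where k: "Im (x $ k) \<noteq> 0" by blast
    with im[of k k] consider "Im (y $ k) = Im (x $ k)" | "Im (y $ k) = - Im (x $ k)"
      using square_eq_iff[of "Im (y $ k)" "Im (x $ k)"] by auto
    then show "x = y \<or> x = cnj_vec y"
    proof cases
      case 1
      then have "Im (x $ l) = Im (y $ l)" for l using im[of k l] k by simp
      then show ?thesis using re by (simp add: vec_eq_iff complex_eq_iff)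
    next
      case 2
      then have "Im (x $ l) = - Im (y $ l)" for l
        using im[of k l] k by (metis mult_cancel_left mult_minus_left mult_minus_right)
      then show ?thesis using re by (simp add: vec_eq_iff complex_eq_iff cnj_vec_def)
    qed
  next
    case False
    then have "Im (y $ k) = 0" for k using im[of k k] by simp
    then show "x = y \<or> x = cnj_vec y" using re False by (simp add: vec_eq_iff complex_eq_iff)
  qed
qed

lemma compact_space_power: "compact_space X \<Longrightarrow> compact_space (product_topology (\<lambda>_. X) UNIV)"
  by (simp add: compact_space_product_topology)

text \<open>A power of a quotient map need not be a quotient map in general. Here the source is
  compact and the target Hausdorff, so every continuous surjection is one; this is why
  \<open>torus_mod_conj\<close> had to be shown Hausdorff.\<close>

lemma quotient_map_power:
  assumes X: "compact_space X" and f: "quotient_map X Y f" and Y: "Hausdorff_space Y"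
  shows "quotient_map (product_topology (\<lambda>_. X) (UNIV :: 'c set)) (product_topology (\<lambda>_. Y) UNIV) ((\<circ>) f)"
proof (rule continuous_imp_quotient_map)
  note fXY = quotient_imp_surjective_map[OF f]
  have "continuous_map (product_topology (\<lambda>_. X) UNIV) Y (f \<circ> (\<lambda>x. x i))" for i :: 'c
    using quotient_imp_continuous_map[OF f]
    by (rule continuous_map_compose[OF continuous_map_product_projection[OF UNIV_I]])
  then show "continuous_map (product_topology (\<lambda>_. X) (UNIV :: 'c set)) (product_topology (\<lambda>_. Y) UNIV) ((\<circ>) f)"
    unfolding continuous_map_componentwise_UNIV by (simp add: comp_def)
  have "y \<in> (\<circ>) f ` topspace (product_topology (\<lambda>_. X) UNIV)"
    if "\<forall>i. y i \<in> topspace Y" for y :: "'c \<Rightarrow> 'b"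
  proof (rule image_eqI)
    have "y i \<in> f ` topspace X" for i using that fXY by blast
    then show "y = f \<circ> (\<lambda>i. inv_into (topspace X) f (y i))"
      "(\<lambda>i. inv_into (topspace X) f (y i)) \<in> topspace (product_topology (\<lambda>_. X) UNIV)"
      by (auto simp: fun_eq_iff f_inv_into_f inv_into_into)
  qed
  moreover have "f x \<in> topspace Y" if "x \<in> topspace X" for x using that fXY by blast
  ultimately show "(\<circ>) f ` topspace (product_topology (\<lambda>_. X) (UNIV :: 'c set)) =
      topspace (product_topology (\<lambda>_. Y) UNIV)"
    by (intro equalityI subsetI) (auto simp: PiE_def Pi_iff)
qed (use X Y in \<open>auto simp: compact_space_product_topology Hausdorff_space_product_topology\<close>)

subsection \<open>Joint eigenvectors of commuting unitary matrices\<close>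

text \<open>The Hermitian form, conjugate-linear in the first argument; the real inner product of
  \<open>complex^'k\<close> is its real part.\<close>

definition hdot :: "complex^'k \<Rightarrow> complex^'k \<Rightarrow> complex" where
  "hdot u v = (\<Sum>i\<in>UNIV. cnj (u $ i) * v $ i)"

lemma hdot_add_right: "hdot u (v + w) = hdot u v + hdot u w"
  by (simp add: hdot_def algebra_simps sum.distrib)

lemma hdot_scale_right: "hdot u (c *s v) = c * hdot u v"
  by (simp add: hdot_def sum_distrib_left mult_ac)

lemma hdot_scale_left: "hdot (c *s u) v = cnj c * hdot u v"
  by (simp add: hdot_def sum_distrib_left mult_ac)

lemma hdot_zero_right [simp]: "hdot u 0 = 0"
  by (simp add: hdot_def)

lemma hdot_minus_left: "hdot (- u) v = - hdot u v"
  by (simp add: hdot_def sum_negf)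

lemma hdot_minus_right: "hdot u (- v) = - hdot u v"
  by (simp add: hdot_def sum_negf)

lemma cnj_hdot: "cnj (hdot u v) = hdot v u"
  by (simp add: hdot_def mult.commute)

lemma hdot_self: "hdot v v = of_real ((norm v)\<^sup>2)"
proof -
  have "(norm v)\<^sup>2 = (\<Sum>i\<in>UNIV. (norm (v $ i))\<^sup>2)"
    by (simp add: norm_vec_def L2_set_def sum_nonneg)
  then show ?thesis
    unfolding hdot_def by (simp only: complex_norm_square of_real_sum mult.commute)
qed

lemma hdot_adjoint: "hdot u (A *v w) = hdot (conj_transpose A *v u) w"
  unfolding hdot_def conj_transpose_def matrix_vector_mult_def
  by (simp add: sum_distrib_left sum_distrib_right mult_ac) (rule sum.swap)

lemma hdot_unitary:
  assumes "A \<in> unitary_group"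
  shows "hdot (A *v u) (A *v v) = hdot u v"
  using assms by (simp add: hdot_adjoint matrix_vector_mul_assoc unitary_group_def)

definition matrix_of_columns :: "('k \<Rightarrow> complex^'k) \<Rightarrow> complex^'k^'k" where
  "matrix_of_columns f = (\<chi> i j. f j $ i)"

definition orthonormal :: "('k \<Rightarrow> complex^'k) \<Rightarrow> bool" where
  "orthonormal f \<longleftrightarrow> (\<forall>i j. hdot (f i) (f j) = (if i = j then 1 else 0))"

lemma matrix_of_columns_unitary:
  assumes "orthonormal f"
  shows "matrix_of_columns f \<in> unitary_group"
proof -
  have "conj_transpose (matrix_of_columns f) ** matrix_of_columns f = mat 1"
    using assms
    by (simp add: orthonormal_def hdot_def conj_transpose_def matrix_of_columns_def
        matrix_matrix_mult_def mat_def vec_eq_iff)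
  then show ?thesis
    by (simp add: unitary_group_def matrix_left_right_inverse)
qed

definition diag_tuple :: "('k \<Rightarrow> complex^'n) \<Rightarrow> (complex^'k^'k)^'n" where
  "diag_tuple z = (\<chi> i a b. if a = b then z a $ i else 0)"

text \<open>The eigenvector equations are the columns of A_i g = g D_i, where g has the vectors
  \<open>f j\<close> as columns and D_i is the diagonal matrix of eigenvalues; g is unitary and can
  be moved to the other side.\<close>

lemma conjugate_diag_tuple:
  assumes f: "orthonormal f" and A: "\<And>i j. A $ i *v f j = z j $ i *s f j"
  shows "A = conjugate_tuple (matrix_of_columns f) (diag_tuple z)"
proof -
  let ?g = "matrix_of_columns f"
  have g: "?g \<in> unitary_group" by (rule matrix_of_columns_unitary[OF f])
  have "A $ i ** ?g = ?g ** diag_tuple z $ i" for i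
  proof -
    have "(A $ i ** ?g) $ a $ b = (?g ** diag_tuple z $ i) $ a $ b" for a b
    proof -
      have "(A $ i ** ?g) $ a $ b = (A $ i *v f b) $ a"
        by (simp add: matrix_of_columns_def matrix_matrix_mult_def matrix_vector_mult_def)
      also have "\<dots> = (?g ** diag_tuple z $ i) $ a $ b"
        by (simp add: A matrix_of_columns_def matrix_matrix_mult_def diag_tuple_def if_distrib
            mult.commute cong: if_cong)
      finally show ?thesis .
    qed
    then show ?thesis by (simp add: vec_eq_iff)
  qed
  then have "?g ** diag_tuple z $ i ** conj_transpose ?g = A $ i ** (?g ** conj_transpose ?g)" for i
    by (simp add: matrix_mul_assoc)
  then show ?thesis
    using g unfolding vec_eq_iff[of A] conjugate_tuple_def
    by (simp add: matrix_inv_unitary) (simp add: unitary_group_def)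
qed

text \<open>A zero row makes the determinant vanish. This is the dimension count behind both
  orthogonal vectors and annihilating polynomials: a homogeneous system with fewer equations than
  unknowns, padded to a square one.\<close>

lemma exists_kernel_vector:
  fixes M :: "complex^'k^'k"
  assumes "\<And>i. M $ j $ i = 0"
  obtains w where "w \<noteq> 0" "M *v w = 0"
proof -
  have "row j M = 0" using assms by (simp add: row_def vec_eq_iff)
  then have "det M = 0" by (rule det_zero_row)
  then have "\<not> (\<exists>B. B ** M = mat 1)"
    using invertible_det_nz invertible_left_inverse by metis
  then show thesis using that unfolding matrix_left_invertible_ker by blast
qed

text \<open>The orthogonality conditions are the rows of a square matrix whose rows outside
  \<open>S\<close> are filled with zeros; row \<open>j\<close> is one of these.\<close>

lemma exists_orthogonal_vector:
  fixes f :: "'k \<Rightarrow> complex^'k"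
  assumes "j \<notin> S"
  obtains w where "w \<noteq> 0" "\<And>i. i \<in> S \<Longrightarrow> hdot (f i) w = 0"
proof -
  define M :: "complex^'k^'k" where "M = (\<chi> i k. if i \<in> S then cnj (f i $ k) else 0)"
  obtain w where w: "w \<noteq> 0" "M *v w = 0"
    by (rule exists_kernel_vector[of M j]) (use assms in \<open>simp_all add: M_def\<close>)
  have "hdot (f i) w = (M *v w) $ i" if "i \<in> S" for i
    using that by (simp add: M_def hdot_def matrix_vector_mult_def)
  then show thesis using that w by simp
qed

text \<open>This is p(A) v evaluated by Horner's rule, so that only vectors and no matrix powers
  occur.\<close>

definition poly_action :: "complex^'k^'k \<Rightarrow> complex poly \<Rightarrow> complex^'k \<Rightarrow> complex^'k" where
  "poly_action A p v = fold_coeffs (\<lambda>a u. a *s v + A *v u) p 0"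

lemma poly_action_0 [simp]: "poly_action A 0 v = 0"
  by (simp add: poly_action_def)

lemma poly_action_pCons [simp]: "poly_action A (pCons a p) v = a *s v + A *v poly_action A p v"
  by (cases "p = 0 \<and> a = 0") (auto simp: poly_action_def)

lemma poly_action_add: "poly_action A (p + q) v = poly_action A p v + poly_action A q v"
  by (induction p q rule: poly_induct2)
    (simp_all add: vector_sadd_rdistrib matrix_vector_right_distrib)

lemma poly_action_smult: "poly_action A (smult c p) v = c *s poly_action A p v"
  by (induction p)
    (simp_all add: vector_add_ldistrib vector_smult_assoc matrix_vector_mult_scaleR vec.scale)

lemma poly_action_sum: "poly_action A (sum p I) v = (\<Sum>i\<in>I. poly_action A (p i) v)"
  by (induction I rule: infinite_finite_induct) (simp_all add: poly_action_add)

lemma poly_action_monom: "poly_action A (monom c n) v = c *s (((*v) A ^^ n) v)"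
  by (induction n) (simp_all add: monom_0 monom_Suc vec.scale)

text \<open>The \<open>d + 1\<close> vectors \<open>A\<^sup>i v\<close>, \<open>i \<le> d\<close>, in dimension \<open>d\<close> are the columns of a square matrix
  with one zero row.\<close>

lemma exists_annihilating_poly:
  fixes A :: "complex^'k^'k"
  obtains p where "p \<noteq> 0" "poly_action A p v = 0"
proof -
  \<comment> \<open>Distinct exponents \<open>e x\<close> keep the coefficients \<open>c $ x\<close>
    of the relation apart in \<open>p\<close>, so a nontrivial relation gives a nonzero polynomial.
    The extra index \<open>None\<close> supplies both the additional vector and the zero
    row.\<close>
  obtain e :: "'k option \<Rightarrow> nat" where e: "inj e"
    using finite_imp_inj_to_nat_seg[of "UNIV :: 'k option set"] by auto
  define M :: "complex^('k option)^('k option)" where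
    "M = (\<chi> i x. case i of None \<Rightarrow> 0 | Some a \<Rightarrow> (((*v) A ^^ e x) v) $ a)"
  obtain c where c: "c \<noteq> 0" "M *v c = 0"
    by (rule exists_kernel_vector[of M None]) (simp_all add: M_def)
  define p where "p = (\<Sum>x\<in>UNIV. monom (c $ x) (e x))"
  have "poly_action A p v $ a = (M *v c) $ Some a" for a
    by (simp add: p_def M_def poly_action_sum poly_action_monom matrix_vector_mult_def mult.commute)
  then have "poly_action A p v = 0" by (simp add: c vec_eq_iff)
  moreover have "coeff p (e x) = c $ x" for x
  proof -
    have "coeff p (e x) = (\<Sum>y\<in>UNIV. if y = x then c $ y else 0)"
      unfolding p_def coeff_sum using e by (intro sum.cong) (auto simp: inj_eq)
    then show ?thesis by simp
  qed
  then have "p \<noteq> 0" using c(1) by (metis coeff_0 vec_eq_iff zero_index)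
  ultimately show thesis using that by blast
qed

text \<open>Among the nonzero polynomials that kill some nonzero vector of \<open>W\<close>, take
  one of least degree, say p killing v. If p = (X - c) q, then minimality forbids q(A) v = 0, so
  q(A) v is an eigenvector for c, and it lies in \<open>W\<close>.\<close>

lemma exists_eigenvector_in_subspace:
  fixes A :: "complex^'k^'k"
  assumes W: "vec.subspace W" and inv: "\<And>w. w \<in> W \<Longrightarrow> A *v w \<in> W" and nz: "w \<in> W" "w \<noteq> 0"
  obtains v c where "v \<in> W" "v \<noteq> 0" "A *v v = c *s v"
proof -
  have W_action: "poly_action A p v \<in> W" if "v \<in> W" for p v
    using that by (induction p) (auto intro!: vec.subspace_add vec.subspace_scale inv vec.subspace_0 W)
  define P where "P = (\<lambda>p. p \<noteq> 0 \<and> (\<exists>v\<in>W. v \<noteq> 0 \<and> poly_action A p v = 0))"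
  have "\<exists>p. P p" unfolding P_def using exists_annihilating_poly[of A w] nz by metis
  then obtain p where p: "P p" and min: "\<And>q. P q \<Longrightarrow> degree p \<le> degree q"
    using arg_min_natI[of P _ degree] arg_min_nat_le[of P _ degree] by metis
  then obtain v where v: "v \<in> W" "v \<noteq> 0" "poly_action A p v = 0" and p0: "p \<noteq> 0"
    unfolding P_def by blast
  have "degree p \<noteq> 0"
  proof
    assume "degree p = 0"
    then obtain a where "p = [:a:]" by (rule degree_eq_zeroE)
    then show False using v p0 by simp
  qed
  then obtain c where "poly p c = 0"
    using fundamental_theorem_of_algebra constant_degree by metis
  then obtain q where q: "p = [:- c, 1:] * q" using poly_eq_0_iff_dvd by blast
  then have q0: "q \<noteq> 0" using p0 by auto
  have "degree p = Suc (degree q)" unfolding q using q0 by (subst degree_mult_eq) auto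
  then have "\<not> P q" using min by fastforce
  then have "poly_action A q v \<noteq> 0" unfolding P_def using q0 v by blast
  moreover have "A *v poly_action A q v = c *s poly_action A q v"
  proof -
    have "p = pCons 0 q + smult (- c) q" by (simp add: q)
    with v(3) have "A *v poly_action A q v + (- c) *s poly_action A q v = 0"
      by (simp only: poly_action_add poly_action_smult poly_action_pCons vector_smult_lzero add_0)
    then show ?thesis by (simp add: vector_smult_lneg add_eq_0_iff2)
  qed
  ultimately show thesis using that W_action v(1) by blast
qed

text \<open>Shrink \<open>W\<close> one index at a time to an eigenspace of the next matrix. The
  induction keeps \<open>V\<close> invariant under all the matrices, not only those already scalar
  on it; commutation passes this invariance on to the next eigenspace.\<close>

lemma exists_joint_eigenvector:
  fixes A :: "(complex^'k^'k)^'n"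
  assumes comm: "\<And>i j. A $ i ** A $ j = A $ j ** A $ i"
    and W: "vec.subspace W" and inv: "\<And>i w. w \<in> W \<Longrightarrow> A $ i *v w \<in> W" and nz: "w \<in> W" "w \<noteq> 0"
  obtains v c where "v \<in> W" "v \<noteq> 0" "\<And>i. A $ i *v v = c $ i *s v"
proof -
  have "\<exists>V v. vec.subspace V \<and> V \<subseteq> W \<and> (\<forall>i. \<forall>w\<in>V. A $ i *v w \<in> V) \<and> v \<in> V \<and> v \<noteq> 0
      \<and> (\<forall>i\<in>I. \<exists>c. \<forall>w\<in>V. A $ i *v w = c *s w)" if "finite I" for I
    using that
  proof (induction I)
    case empty
    show ?case using W inv nz by blast
  next
    case (insert k I)
    then obtain V v where V: "vec.subspace V" "V \<subseteq> W" "\<And>i w. w \<in> V \<Longrightarrow> A $ i *v w \<in> V"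
        "v \<in> V" "v \<noteq> 0" "\<forall>i\<in>I. \<exists>c. \<forall>w\<in>V. A $ i *v w = c *s w"
      by metis
    obtain u c where u: "u \<in> V" "u \<noteq> 0" "A $ k *v u = c *s u"
      by (rule exists_eigenvector_in_subspace[OF V(1,3,4,5)])
    define V' where "V' = {w \<in> V. A $ k *v w = c *s w}"
    have "A $ k *v (A $ i *v w) = c *s (A $ i *v w)" if "A $ k *v w = c *s w" for i w
      using that comm[of k i] by (metis matrix_vector_mul_assoc vec.scale)
    then have "\<forall>i. \<forall>w\<in>V'. A $ i *v w \<in> V'" using V(3) by (simp add: V'_def)
    moreover have "vec.subspace V'"
      using V(1) unfolding vec.subspace_def V'_def
      by (auto simp: matrix_vector_right_distrib vec.scale vector_add_ldistrib vector_smult_assoc mult.commute)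
    moreover have "\<forall>i\<in>insert k I. \<exists>c. \<forall>w\<in>V'. A $ i *v w = c *s w"
      using V(6) unfolding V'_def by blast
    ultimately show ?case using V(2) u unfolding V'_def by (intro exI[of _ V'] exI[of _ u]) (auto simp: V'_def)
  qed
  from this[of UNIV] obtain V v where V: "V \<subseteq> W" "v \<in> V" "v \<noteq> 0"
      and "\<forall>i. \<exists>c. \<forall>w\<in>V. A $ i *v w = c *s w"
    by auto
  then obtain c where "\<And>i. \<forall>w\<in>V. A $ i *v w = c i *s w" by metis
  then show thesis using V by (intro that[of v "\<chi> i. c i"]) auto
qed

lemma exists_unit_joint_eigenvector:
  fixes A :: "(complex^'k^'k)^'n"
  assumes comm: "\<And>i j. A $ i ** A $ j = A $ j ** A $ i"
    and W: "vec.subspace W" and inv: "\<And>i w. w \<in> W \<Longrightarrow> A $ i *v w \<in> W" and nz: "w \<in> W" "w \<noteq> 0"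
  obtains v c where "v \<in> W" "hdot v v = 1" "\<forall>i. A $ i *v v = c $ i *s v"
proof -
  obtain v c where v: "v \<in> W" "v \<noteq> 0" "\<And>i. A $ i *v v = c $ i *s v"
    using exists_joint_eigenvector[OF assms] by blast
  let ?r = "complex_of_real (inverse (norm v))"
  have "hdot (?r *s v) (?r *s v) = 1"
    using v(2) unfolding hdot_scale_left hdot_scale_right hdot_self[of v]
    by (simp add: power2_eq_square field_simps)
  moreover have "A $ i *v (?r *s v) = c $ i *s (?r *s v)" for i
    by (simp add: vec.scale v(3) vector_smult_assoc mult.commute)
  ultimately show thesis using that vec.subspace_scale[OF W v(1)] by blast
qed

lemma subspace_orthogonal: "vec.subspace {w. \<forall>u\<in>B. hdot u w = 0}"
  by (auto simp: vec.subspace_def hdot_add_right hdot_scale_right)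

lemma unitary_eigenvalue:
  assumes A: "A \<in> unitary_group" and v: "hdot v v = 1" "A *v v = c *s v"
  shows "norm c = 1" and "conj_transpose A *v v = cnj c *s v"
proof -
  have "cnj c * c = 1"
    using hdot_unitary[OF A, of v v] v by (simp add: hdot_scale_left hdot_scale_right mult.commute)
  then have "(norm c)\<^sup>2 = 1"
    by (metis complex_norm_square mult.commute of_real_eq_1_iff)
  then show "norm c = 1" using norm_ge_zero[of c] unfolding power2_eq_1_iff by linarith
  have "v = conj_transpose A *v (A *v v)"
    using A by (simp add: matrix_vector_mul_assoc unitary_group_def)
  then have "v = c *s (conj_transpose A *v v)" unfolding v vec.scale .
  then have "cnj c *s v = (cnj c * c) *s (conj_transpose A *v v)"
    by (metis vector_smult_assoc)
  then show "conj_transpose A *v v = cnj c *s v" using \<open>cnj c * c = 1\<close> by simp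
qed

text \<open>An eigenvector of a unitary matrix is also one of its adjoint, so the matrix can be
  moved to the left argument.\<close>

lemma orthogonal_complement_invariant:
  assumes "A \<in> unitary_group" "hdot u u = 1" "A *v u = c *s u" "hdot u w = 0"
  shows "hdot u (A *v w) = 0"
  using assms(4) by (simp add: hdot_adjoint unitary_eigenvalue(2)[OF assms(1-3)] hdot_scale_left)

subsection \<open>Quaternionic structure and orthonormal frames\<close>

text \<open>The antilinear structure map of \<open>\<complex>\<^sup>m \<oplus> \<complex>\<^sup>m\<close> viewed as quaternionic \<open>m\<close>-space.\<close>

definition quat_j :: "complex^('m::finite + 'm) \<Rightarrow> complex^('m + 'm)" where
  "quat_j v = (\<chi> x. case x of Inl a \<Rightarrow> - cnj (v $ Inr a) | Inr a \<Rightarrow> cnj (v $ Inl a))"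

lemma quat_j_nth [simp]:
  "quat_j v $ Inl a = - cnj (v $ Inr a)" "quat_j v $ Inr a = cnj (v $ Inl a)"
  by (simp_all add: quat_j_def)

lemma vec_eq_iff_sum: "u = v \<longleftrightarrow> (\<forall>a. u $ Inl a = v $ Inl a) \<and> (\<forall>a. u $ Inr a = v $ Inr a)"
  unfolding vec_eq_iff by (metis sum.exhaust)

lemma sum_UNIV_sum:
  fixes h :: "'a::finite + 'b::finite \<Rightarrow> 'c::comm_monoid_add"
  shows "sum h UNIV = (\<Sum>a\<in>UNIV. h (Inl a)) + (\<Sum>b\<in>UNIV. h (Inr b))"
  using sum.Plus[of UNIV UNIV h] by (simp add: UNIV_Plus_UNIV comp_def)

lemma quat_j_quat_j [simp]: "quat_j (quat_j v) = - v"
  by (simp add: vec_eq_iff_sum)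

lemma quat_j_scale: "quat_j (c *s v) = cnj c *s quat_j v"
  by (simp add: vec_eq_iff_sum)

lemma hdot_quat_j_quat_j: "hdot (quat_j u) (quat_j v) = cnj (hdot u v)"
  by (simp add: hdot_def sum_UNIV_sum add.commute)

lemma hdot_quat_j_left: "hdot (quat_j u) v = - cnj (hdot u (quat_j v))"
  using hdot_quat_j_quat_j[of u "quat_j v"] by (metis add.inverse_inverse hdot_minus_right quat_j_quat_j)

lemma hdot_quat_j_self: "hdot u (quat_j u) = 0"
  by (simp add: hdot_def sum_UNIV_sum sum_negf mult.commute)

lemma symplectic_J_nth [simp]:
  "symplectic_J $ Inl a $ Inl b = 0" "symplectic_J $ Inr a $ Inr b = 0"
  "symplectic_J $ Inl a $ Inr b = (if a = b then 1 else 0)"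
  "symplectic_J $ Inr a $ Inl b = (if a = b then - 1 else 0)"
  by (simp_all add: symplectic_J_def)

lemma symplectic_J_mult_vec: "symplectic_J *v v = quat_j (- cnj_vec v)"
  by (simp add: vec_eq_iff_sum matrix_vector_mult_def sum_UNIV_sum if_distrib if_distribR sum_negf
      cong: if_cong)

text \<open>The right-hand side is the complex bilinear symplectic form u^T J v, here expressed
  through the Hermitian form and \<open>quat_j\<close>.\<close>

lemma hdot_quat_j: "hdot (quat_j u) v = hdot (cnj_vec u) (symplectic_J *v v)"
  by (simp add: hdot_def symplectic_J_mult_vec sum_UNIV_sum sum_negf)

lemma hdot_cnj_vec_mult: "hdot (cnj_vec (A *v u)) w = hdot (cnj_vec u) (transpose A *v w)"
  unfolding hdot_def matrix_vector_mult_def transpose_def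
  by (simp add: sum_distrib_left sum_distrib_right mult_ac) (rule sum.swap)

lemma hdot_quat_j_mult:
  "hdot (quat_j (A *v u)) (A *v v) = hdot (cnj_vec u) ((transpose A ** symplectic_J ** A) *v v)"
  by (simp add: hdot_quat_j hdot_cnj_vec_mult matrix_vector_mul_assoc matrix_mul_assoc)

text \<open>\<open>A\<close> preserves the Hermitian form and the symplectic form, so the difference
  \<open>?d\<close> of the two sides is orthogonal to every \<open>A *v w\<close>. As
  \<open>A\<close> is invertible, \<open>?d\<close> is itself of this form and hence zero.\<close>

lemma quat_j_symplectic:
  assumes "A \<in> compact_symplectic_group"
  shows "A *v quat_j v = quat_j (A *v v)"
proof -
  have A: "A \<in> unitary_group" "transpose A ** symplectic_J ** A = symplectic_J"
    using assms by (auto simp: compact_symplectic_group_def)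
  let ?d = "quat_j (A *v v) - A *v quat_j v"
  have "hdot ?d (A *v w) = 0" for w
  proof -
    have "hdot (quat_j (A *v v)) (A *v w) = hdot (A *v quat_j v) (A *v w)"
      unfolding hdot_quat_j_mult A(2) hdot_unitary[OF A(1)] by (simp add: hdot_quat_j)
    then show ?thesis by (simp add: hdot_def algebra_simps sum_subtractf)
  qed
  from this[of "conj_transpose A *v ?d"] have "hdot ?d ?d = 0"
    using A(1) by (simp add: matrix_vector_mul_assoc unitary_group_def)
  then show ?thesis by (simp add: hdot_self)
qed

text \<open>Antilinearity of \<open>quat_j\<close> conjugates the eigenvalue; this is where the
  action of Z/2 on the torus comes from.\<close>

lemma quat_j_eigenvector:
  assumes "A \<in> compact_symplectic_group" "A *v v = c *s v"
  shows "A *v quat_j v = cnj c *s quat_j v"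
  using quat_j_symplectic[OF assms(1)] assms(2) by (simp add: quat_j_scale)

lemma matrix_nth_eq_hdot: "M $ a $ b = hdot (axis a 1) (M *v axis b 1)"
  by (simp add: hdot_def axis_def matrix_vector_mult_def if_distrib if_distribR cong: if_cong)

definition quat_frame :: "('m::finite \<Rightarrow> complex^('m + 'm)) \<Rightarrow> 'm + 'm \<Rightarrow> complex^('m + 'm)" where
  "quat_frame f = case_sum f (quat_j \<circ> f)"

lemma quat_frame_simps [simp]: "quat_frame f (Inl a) = f a" "quat_frame f (Inr a) = quat_j (f a)"
  by (simp_all add: quat_frame_def)

lemma orthonormal_quat_frame:
  assumes "\<And>i j. hdot (f i) (f j) = (if i = j then 1 else 0)"
    and "\<And>i j. hdot (f i) (quat_j (f j)) = 0"
  shows "orthonormal (quat_frame f)"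
  unfolding orthonormal_def
proof (intro allI)
  fix x y :: "'a + 'a"
  show "hdot (quat_frame f x) (quat_frame f y) = (if x = y then 1 else 0)"
    by (cases x; cases y) (simp_all add: assms hdot_quat_j_quat_j hdot_quat_j_left[of _ "f _"] hdot_minus_right)
qed

lemma matrix_of_columns_axis: "matrix_of_columns f *v axis b 1 = f b"
  by (simp add: matrix_of_columns_def matrix_vector_mult_def axis_def vec_eq_iff if_distrib if_distribR
      cong: if_cong)

lemma cnj_vec_axis [simp]: "cnj_vec (axis a 1) = axis a 1"
  by (simp add: axis_def vec_eq_iff)

text \<open>The entries of g^T J g are the products
  \<open>hdot (quat_j (quat_frame f a)) (quat_frame f b)\<close>. Up to sign \<open>quat_j\<close>
  permutes the frame, exchanging the two halves, with exactly the signs of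
  \<open>symplectic_J\<close>.\<close>

lemma matrix_of_quat_frame_symplectic:
  assumes "orthonormal (quat_frame f)"
  shows "matrix_of_columns (quat_frame f) \<in> compact_symplectic_group"
proof -
  let ?g = "matrix_of_columns (quat_frame f)"
  have "(transpose ?g ** symplectic_J ** ?g) $ a $ b = symplectic_J $ a $ b" for a b
  proof -
    have "(transpose ?g ** symplectic_J ** ?g) $ a $ b =
        hdot (quat_j (quat_frame f a)) (quat_frame f b)"
      using hdot_quat_j_mult[of ?g "axis a 1" "axis b 1"]
      by (simp add: matrix_of_columns_axis matrix_nth_eq_hdot[of _ a b])
    also have "\<dots> = symplectic_J $ a $ b"
    proof (cases a)
      case (Inl i)
      then have "quat_j (quat_frame f a) = quat_frame f (Inr i)" by simp
      then have "hdot (quat_j (quat_frame f a)) (quat_frame f b) = (if Inr i = b then 1 else 0)"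
        using assms by (simp only: orthonormal_def)
      then show ?thesis by (cases b) (auto simp: Inl)
    next
      case (Inr i)
      then have "quat_j (quat_frame f a) = - quat_frame f (Inl i)" by simp
      then have "hdot (quat_j (quat_frame f a)) (quat_frame f b) = - (if Inl i = b then 1 else 0)"
        using assms by (simp only: orthonormal_def hdot_minus_left)
      then show ?thesis by (cases b) (auto simp: Inr)
    qed
    finally show ?thesis .
  qed
  then show ?thesis
    using matrix_of_columns_unitary[OF assms]
    by (simp add: compact_symplectic_group_def vec_eq_iff)
qed

text \<open>The orthogonal complement of the joint eigenvectors found so far is invariant and
  nonzero, so it contains a further one. Induction over the index set \<open>S\<close> fills the
  frame one index at a time.\<close>

lemma exists_unitary_frame:
  fixes A :: "(complex^'k^'k)^'n"
  assumes A: "A \<in> commuting_tuples unitary_group"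
  obtains f z where "orthonormal f" "\<And>i j. A $ i *v f j = z j $ i *s f j"
proof -
  have U: "A $ i \<in> unitary_group" and comm: "A $ i ** A $ j = A $ j ** A $ i" for i j
    using A by (auto simp: commuting_tuples_def)
  have "\<exists>f z. (\<forall>i\<in>S. \<forall>j\<in>S. hdot (f i) (f j) = (if i = j then 1 else 0)) \<and>
      (\<forall>j\<in>S. \<forall>i. A $ i *v f j = z j $ i *s f j)"
    if "finite S" for S :: "'k set"
    using that
  proof (induction S)
    case (insert k S)
    then obtain f :: "'k \<Rightarrow> complex^'k" and z where
      f: "\<forall>i\<in>S. \<forall>j\<in>S. hdot (f i) (f j) = (if i = j then 1 else 0)"
      and z: "\<forall>j\<in>S. \<forall>i. A $ i *v f j = z j $ i *s f j" by metis
    let ?W = "{w. \<forall>u\<in>f ` S. hdot u w = 0}"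
    obtain w where w0: "w \<noteq> 0" "\<And>i. i \<in> S \<Longrightarrow> hdot (f i) w = 0"
      using exists_orthogonal_vector[OF insert.hyps(2), of f] by blast
    then have w: "w \<noteq> 0" "w \<in> ?W" by auto
    have "A $ i *v w \<in> ?W" if "w \<in> ?W" for i w
    proof (intro CollectI ballI)
      fix u assume "u \<in> f ` S"
      then obtain j where j: "j \<in> S" "u = f j" by blast
      with f z have "hdot u u = 1" "A $ i *v u = z j $ i *s u" by auto
      then show "hdot u (A $ i *v w) = 0"
        by (rule orthogonal_complement_invariant[OF U]) (use that j in auto)
    qed
    then obtain v c where v: "v \<in> ?W" "hdot v v = 1" "\<forall>i. A $ i *v v = c $ i *s v"
      by (rule exists_unit_joint_eigenvector[OF comm subspace_orthogonal _ w(2,1)])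
    have "hdot (f i) v = 0 \<and> hdot v (f i) = 0" if "i \<in> S" for i
      using v(1) that cnj_hdot[of "f i" v] by auto
    then show ?case
      using f z v(2,3) insert.hyps(2)
      by (intro exI[of _ "f(k := v)"] exI[of _ "z(k := c)"]) auto
  qed simp
  from this[of UNIV] obtain f :: "'k \<Rightarrow> complex^'k" and z
    where f: "\<forall>i j. hdot (f i) (f j) = (if i = j then 1 else 0)"
      and z: "\<forall>j i. A $ i *v f j = z j $ i *s f j"
    by auto
  from f have "orthonormal f" by (simp add: orthonormal_def)
  then show thesis using z by (intro that) auto
qed

text \<open>The orthogonal complement of a set of joint eigenvectors that is stable under the quaternionic
  structure is again stable, so eigenvectors can be added in pairs \<open>v\<close>, \<open>quat_j v\<close>.\<close>

lemma exists_symplectic_frame: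
  fixes A :: "(complex^('m::finite + 'm)^('m + 'm))^'n"
  assumes A: "A \<in> commuting_tuples compact_symplectic_group"
  obtains f z where "orthonormal (quat_frame f)" "\<And>i j. A $ i *v f j = z j $ i *s f j"
proof -
  have Sp: "A $ i \<in> compact_symplectic_group" and comm: "A $ i ** A $ j = A $ j ** A $ i" for i j
    using A by (auto simp: commuting_tuples_def)
  then have U: "A $ i \<in> unitary_group" for i
    by (auto simp: compact_symplectic_group_def)
  have "\<exists>f z. (\<forall>i\<in>S. \<forall>j\<in>S. hdot (f i) (f j) = (if i = j then 1 else 0) \<and>
        hdot (f i) (quat_j (f j)) = 0) \<and> (\<forall>j\<in>S. \<forall>i. A $ i *v f j = z j $ i *s f j)"
    if "finite S" for S :: "'m set"
    using that
  proof (induction S)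
    case (insert k S)
    then obtain f :: "'m \<Rightarrow> complex^('m + 'm)" and z where
      f: "\<forall>i\<in>S. \<forall>j\<in>S. hdot (f i) (f j) = (if i = j then 1 else 0) \<and> hdot (f i) (quat_j (f j)) = 0"
      and z: "\<forall>j\<in>S. \<forall>i. A $ i *v f j = z j $ i *s f j" by metis
    let ?B = "f ` S \<union> (\<lambda>i. quat_j (f i)) ` S"
    let ?W = "{w. \<forall>u\<in>?B. hdot u w = 0}"
    \<comment> \<open>The vectors chosen so far and their images under \<open>quat_j\<close> occupy
      the indices over \<open>S\<close> in both halves, which leaves \<open>Inl k\<close> free as
      the zero row.\<close>
    have "Inl k \<notin> Inl ` S \<union> Inr ` S" using insert.hyps(2) by auto
    then obtain w where w: "w \<noteq> 0" "\<And>x. x \<in> Inl ` S \<union> Inr ` S \<Longrightarrow> hdot (quat_frame f x) w = 0"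
      using exists_orthogonal_vector[of "Inl k" "Inl ` S \<union> Inr ` S" "quat_frame f"] by blast
    have wW: "w \<in> ?W"
    proof (intro CollectI ballI)
      fix u assume "u \<in> ?B"
      then obtain x where "x \<in> Inl ` S \<union> Inr ` S" "u = quat_frame f x" by fastforce
      then show "hdot u w = 0" using w(2) by blast
    qed
    have unit: "hdot u u = 1" if "u \<in> ?B" for u
      using that f by (auto simp: hdot_quat_j_quat_j)
    have eig: "\<exists>c. A $ i *v u = c *s u" if "u \<in> ?B" for u i
      using that
    proof
      assume "u \<in> f ` S"
      then show ?thesis using z by blast
    next
      assume "u \<in> (\<lambda>i. quat_j (f i)) ` S"
      then obtain j where "j \<in> S" "u = quat_j (f j)" by blast
      then show ?thesis using z quat_j_eigenvector[OF Sp[of i], of "f j"] by blast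
    qed
    have "A $ i *v w \<in> ?W" if w: "w \<in> ?W" for i w
    proof (intro CollectI ballI)
      fix u assume u: "u \<in> ?B"
      then obtain c where "A $ i *v u = c *s u" using eig by blast
      then show "hdot u (A $ i *v w) = 0"
        by (rule orthogonal_complement_invariant[OF U unit[OF u]]) (use w u in blast)
    qed
    then obtain v c where v: "v \<in> ?W" "hdot v v = 1" "\<forall>i. A $ i *v v = c $ i *s v"
      by (rule exists_unit_joint_eigenvector[OF comm subspace_orthogonal _ wW w(1)])
    \<comment> \<open>Orthogonality of \<open>v\<close> to \<open>quat_j (f i)\<close> turns into
      orthogonality of \<open>f i\<close> to \<open>quat_j v\<close>, so the pair \<open>v\<close>,
      \<open>quat_j v\<close> fits the frame.\<close>
    have "hdot (f i) v = 0 \<and> hdot v (f i) = 0 \<and> hdot (f i) (quat_j v) = 0 \<and> hdot v (quat_j (f i)) = 0"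
      if "i \<in> S" for i
      using v(1) that cnj_hdot[of "f i" v] cnj_hdot[of "quat_j (f i)" v] hdot_quat_j_left[of "f i" v]
      by auto
    then show ?case
      using f z v(2,3) insert.hyps(2)
      by (intro exI[of _ "f(k := v)"] exI[of _ "z(k := c)"]) (auto simp: hdot_quat_j_self)
  qed simp
  from this[of UNIV] obtain f :: "'m \<Rightarrow> complex^('m + 'm)" and z
    where f: "\<forall>i j. hdot (f i) (f j) = (if i = j then 1 else 0) \<and> hdot (f i) (quat_j (f j)) = 0"
      and z: "\<forall>j i. A $ i *v f j = z j $ i *s f j"
    by auto
  from f have "orthonormal (quat_frame f)" by (intro orthonormal_quat_frame) auto
  then show thesis using z by (intro that) auto
qed

subsection \<open>Diagonal tuples and conjugation invariants\<close>

text \<open>The joint eigenvalues along a \<open>quat_frame\<close>; the conjugates on the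
  \<open>Inr\<close> half are forced by \<open>quat_j_eigenvector\<close>.\<close>

definition quat_weights :: "('m \<Rightarrow> complex^'n) \<Rightarrow> 'm + 'm \<Rightarrow> complex^'n" where
  "quat_weights z = case_sum z (cnj_vec \<circ> z)"

lemma quat_weights_simps [simp]:
  "quat_weights z (Inl a) = z a" "quat_weights z (Inr a) = cnj_vec (z a)"
  by (simp_all add: quat_weights_def)

lemma quat_frame_eigenvectors:
  assumes "\<And>i. A $ i \<in> compact_symplectic_group" "\<And>i j. A $ i *v f j = z j $ i *s f j"
  shows "A $ i *v quat_frame f x = quat_weights z x $ i *s quat_frame f x"
proof (cases x)
  case (Inr a)
  then show ?thesis
    using quat_j_eigenvector[OF assms(1)[of i] assms(2)[of i a]] by simp
qed (simp add: assms(2))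

section \<open>Diagonal tuples in the unitary and symplectic groups\<close>

lemma diag_tuple_mult_left: "(diag_tuple z $ i ** M) $ a $ b = z a $ i * M $ a $ b"
  by (simp add: diag_tuple_def matrix_matrix_mult_def if_distrib[of "\<lambda>x. x * _"] cong: if_cong)

lemma diag_tuple_mult_right: "(M ** diag_tuple z $ i) $ a $ b = M $ a $ b * z b $ i"
  by (simp add: diag_tuple_def matrix_matrix_mult_def if_distrib[of "\<lambda>x. _ * x"] cong: if_cong)

lemma diag_tuple_nth: "diag_tuple z $ i $ a $ b = (if a = b then z a $ i else 0)"
  by (simp add: diag_tuple_def)

lemma transpose_diag_tuple: "transpose (diag_tuple z $ i) = diag_tuple z $ i"
  by (simp add: diag_tuple_def transpose_def vec_eq_iff)

lemma diag_tuple_mult: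
  "diag_tuple z $ i ** diag_tuple w $ k = (\<chi> a b. if a = b then z a $ i * w a $ k else 0)"
  by (simp add: vec_eq_iff diag_tuple_mult_left diag_tuple_nth)

lemma conj_transpose_diag_tuple: "conj_transpose (diag_tuple z $ i) = diag_tuple (cnj_vec \<circ> z) $ i"
  by (simp add: diag_tuple_def conj_transpose_def vec_eq_iff)

lemma cnj_mult_eq_1: "norm z = 1 \<Longrightarrow> z * cnj z = 1"
  using complex_norm_square[of z] by simp

lemma diag_tuple_unitary:
  assumes "\<And>j. z j \<in> topspace torus"
  shows "diag_tuple z $ i \<in> unitary_group"
  using assms cnj_mult_eq_1
  by (simp add: unitary_group_def conj_transpose_diag_tuple diag_tuple_mult mat_def topspace_torus
      vec_eq_iff mult.commute)

lemma diag_tuple_commutes: "diag_tuple z $ i ** diag_tuple z $ k = diag_tuple z $ k ** diag_tuple z $ i"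
  by (simp add: vec_eq_iff diag_tuple_mult_left diag_tuple_nth mult.commute)

text \<open>For diagonal D, the entry (a, b) of D^T J D is that of J times the weights at a and b. J
  only pairs \<open>Inl j\<close> with \<open>Inr j\<close>, where the two weights are conjugate of
  norm 1 and their product is 1.\<close>

lemma diag_tuple_symplectic:
  fixes z :: "'m::finite \<Rightarrow> complex^'n"
  assumes "\<And>j. z j \<in> topspace torus"
  shows "diag_tuple (quat_weights z) $ i \<in> compact_symplectic_group"
proof -
  have "quat_weights z x \<in> topspace torus" for x
    using assms by (cases x) (simp_all add: topspace_torus)
  then have "diag_tuple (quat_weights z) $ i \<in> unitary_group" by (rule diag_tuple_unitary)
  moreover have "(transpose D ** symplectic_J ** D) $ a $ b = symplectic_J $ a $ b"
    if D: "D = diag_tuple (quat_weights z) $ i" for a b and D :: "complex^('m + 'm)^('m + 'm)"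
  proof -
    have "(transpose D ** symplectic_J ** D) $ a $ b =
        quat_weights z a $ i * symplectic_J $ a $ b * quat_weights z b $ i"
      unfolding D
      by (simp add: transpose_diag_tuple diag_tuple_mult_left diag_tuple_mult_right)
    also have "\<dots> = symplectic_J $ a $ b"
      using assms cnj_mult_eq_1
      by (cases a; cases b) (auto simp: topspace_torus mult.commute)
    finally show ?thesis .
  qed
  ultimately show ?thesis by (simp add: compact_symplectic_group_def vec_eq_iff)
qed

lemma diag_tuple_axis: "diag_tuple z $ i *v axis a 1 = z a $ i *s axis a 1"
proof -
  have "(\<Sum>k\<in>UNIV. diag_tuple z $ i $ b $ k * axis a 1 $ k) =
      (\<Sum>k\<in>UNIV. if k = a then diag_tuple z $ i $ b $ k else 0)" for b
    by (rule sum.cong) (auto simp: axis_def)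
  then show ?thesis by (simp add: matrix_vector_mult_def vec_eq_iff diag_tuple_nth axis_def)
qed

lemma hdot_axis: "hdot (axis a 1) (axis b 1) = (if a = b then 1 else 0)"
proof -
  have "hdot (axis a 1) (axis b 1) = (\<Sum>k\<in>UNIV. if k = a then (if a = b then 1 else 0) else 0)"
    unfolding hdot_def by (rule sum.cong) (auto simp: axis_def)
  then show ?thesis by simp
qed

lemma quat_j_axis: "quat_j (axis (Inl a) 1) = axis (Inr a) 1" "quat_j (axis (Inr a) 1) = - axis (Inl a) 1"
  by (simp_all add: vec_eq_iff_sum axis_def)

text \<open>Shared by U(m) and Sp(m). Inverses are expressed by \<open>conj_transpose\<close>, which
  agrees with \<open>matrix_inv\<close> on unitary matrices.\<close>

locale unitary_subgroup =
  fixes G :: "(complex^'k^'k) set"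
  assumes unitary: "G \<subseteq> unitary_group"
    and mult: "\<And>g h. \<lbrakk>g \<in> G; h \<in> G\<rbrakk> \<Longrightarrow> g ** h \<in> G"
    and one: "mat 1 \<in> G"
    and inverse: "\<And>g. g \<in> G \<Longrightarrow> conj_transpose g \<in> G"
begin

abbreviation "conj_orbit \<equiv> orbit (conjugate_tuple ` G)"

lemma conj_orbit_def': "conj_orbit A = (\<lambda>g. conjugate_tuple g A) ` G"
  by (simp add: orbit_def image_image)

text \<open>Right translation by \<open>h\<close> permutes \<open>G\<close>.\<close>

lemma conj_orbit_conjugate:
  assumes h: "h \<in> G"
  shows "conj_orbit (conjugate_tuple h A) = conj_orbit A"
proof -
  have hU: "h \<in> unitary_group" using h unitary by blast
  have "g \<in> (\<lambda>k. k ** h) ` G" if "g \<in> G" for g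
  proof (rule image_eqI)
    show "g = g ** conj_transpose h ** h"
      using hU by (simp add: matrix_mul_assoc[symmetric] unitary_group_def)
  qed (use that h mult inverse in blast)
  then have "(\<lambda>k. k ** h) ` G = G"
    using h mult by blast
  moreover have "conj_orbit (conjugate_tuple h A) = (\<lambda>k. conjugate_tuple k A) ` ((\<lambda>k. k ** h) ` G)"
    unfolding conj_orbit_def' image_image using unitary hU
    by (intro image_cong refl conjugate_tuple_mult) auto
  ultimately show ?thesis by (simp add: conj_orbit_def')
qed

lemma conj_orbit_eqD:
  assumes "conj_orbit A = conj_orbit B"
  obtains g where "g \<in> G" "A = conjugate_tuple g B"
proof -
  have "conjugate_tuple (mat 1) A = A"
    by (simp add: conjugate_tuple_def matrix_inv_unitary mat_1_in_unitary_group vec_eq_iff)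
  then have "A \<in> conj_orbit A" unfolding conj_orbit_def' using one by (metis image_eqI)
  then have "A \<in> conj_orbit B" using assms by simp
  then have "A \<in> (\<lambda>g. conjugate_tuple g B) ` G" by (simp only: conj_orbit_def')
  then show thesis by (rule imageE) (rule that)
qed
end

interpretation unitary: unitary_subgroup "unitary_group :: (complex^'k^'k) set"
  by unfold_locales (auto simp: unitary_group_mult unitary_group_conj_transpose mat_1_in_unitary_group)

text \<open>Commuting with \<open>quat_j\<close> is quaternionic linearity. In this form closure
  under products and adjoints is easy to see, which the interpretation below needs.\<close>

lemma symplectic_iff_quat_j:
  "A \<in> compact_symplectic_group \<longleftrightarrow> A \<in> unitary_group \<and> (\<forall>v. A *v quat_j v = quat_j (A *v v))"
proof (intro iffI conjI allI)
  assume "A \<in> unitary_group \<and> (\<forall>v. A *v quat_j v = quat_j (A *v v))"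
  then have A: "A \<in> unitary_group" and q: "\<And>v. quat_j (A *v v) = A *v quat_j v" by simp_all
  have "(transpose A ** symplectic_J ** A) $ a $ b = symplectic_J $ a $ b" for a b
    using hdot_quat_j_mult[of A "axis a 1" "axis b 1"] hdot_quat_j[of "axis a 1" "axis b 1"]
    unfolding q hdot_unitary[OF A] by (simp add: matrix_nth_eq_hdot[of _ a b])
  then show "A \<in> compact_symplectic_group"
    using A by (simp add: compact_symplectic_group_def vec_eq_iff)
qed (simp_all add: quat_j_symplectic, simp add: compact_symplectic_group_def)

interpretation symplectic: unitary_subgroup
  "compact_symplectic_group :: (complex^('m::finite + 'm)^('m + 'm)) set"
proof
  show "(compact_symplectic_group :: (complex^('m + 'm)^('m + 'm)) set) \<subseteq> unitary_group"
    by (auto simp: compact_symplectic_group_def)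
  fix g h :: "complex^('m + 'm)^('m + 'm)"
  assume g: "g \<in> compact_symplectic_group"
  then have gU: "g \<in> unitary_group" by (simp add: symplectic_iff_quat_j)
  have "conj_transpose g *v quat_j v = quat_j (conj_transpose g *v v)" for v
  proof -
    have "g *v quat_j (conj_transpose g *v v) = quat_j v"
      using gU by (simp add: quat_j_symplectic[OF g] matrix_vector_mul_assoc unitary_group_def)
    then have "conj_transpose g *v quat_j v = (conj_transpose g ** g) *v quat_j (conj_transpose g *v v)"
      by (simp add: matrix_vector_mul_assoc[symmetric])
    then show ?thesis using gU by (simp add: unitary_group_def)
  qed
  then show "conj_transpose g \<in> compact_symplectic_group"
    using gU by (simp add: symplectic_iff_quat_j unitary_group_conj_transpose)
  assume "h \<in> compact_symplectic_group"
  with g show "g ** h \<in> compact_symplectic_group"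
    by (simp add: symplectic_iff_quat_j unitary_group_mult matrix_vector_mul_assoc[symmetric])
qed (simp add: compact_symplectic_group_def mat_1_in_unitary_group)

section \<open>Traces of words in shifted matrices\<close>

lemma mat_commute: "mat (u :: complex) ** M = M ** mat u"
  by (simp add: vec_eq_iff matrix_matrix_mult_def mat_def if_distrib[of "\<lambda>x. x * _"]
      if_distrib[of "\<lambda>x. _ * x"] mult.commute cong: if_cong)

lemma matrix_sub_ldistrib: "(A :: complex^'k^'k) ** (B - C) = A ** B - A ** C"
  and matrix_sub_rdistrib: "(B - C) ** (A :: complex^'k^'k) = B ** A - C ** A"
  by (simp_all add: matrix_matrix_mult_def vec_eq_iff algebra_simps sum_subtractf)

text \<open>The shifts let a factor vanish at a prescribed eigenvalue, so on diagonal tuples a word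
  becomes a product of linear polynomials in the joint eigenvalue with freely chosen zeros.\<close>

fun word :: "('n \<times> complex) list \<Rightarrow> (complex^'k^'k)^'n \<Rightarrow> complex^'k^'k" where
  "word [] A = mat 1"
| "word ((k, u) # L) A = (A $ k - mat u) ** word L A"

definition word_trace :: "('n \<times> complex) list \<Rightarrow> (complex^'k^'k)^'n \<Rightarrow> complex" where
  "word_trace L A = trace (word L A)"

lemma word_conjugate:
  assumes "g \<in> unitary_group"
  shows "word L (conjugate_tuple g A) = g ** word L A ** conj_transpose g"
proof (induction L A rule: word.induct)
  case (1 A)
  then show ?case using assms by (simp add: unitary_group_def)
next
  case (2 k u L A)
  have g: "conj_transpose g ** g = mat 1" "g ** conj_transpose g = mat 1"
    using assms by (auto simp: unitary_group_def)
  have "g ** (mat u ** conj_transpose g) = mat u"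
    unfolding mat_commute[of u "conj_transpose g"] matrix_mul_assoc g(2) by simp
  then have "conjugate_tuple g A $ k - mat u = g ** ((A $ k - mat u) ** conj_transpose g)"
    by (simp add: conjugate_tuple_def matrix_inv_unitary[OF assms] matrix_sub_ldistrib
        matrix_sub_rdistrib matrix_mul_assoc)
  then have "word ((k, u) # L) (conjugate_tuple g A) =
      g ** (A $ k - mat u) ** (conj_transpose g ** g) ** word L A ** conj_transpose g"
    by (simp add: 2 matrix_mul_assoc)
  then show ?case by (simp add: g matrix_mul_assoc)
qed

lemma word_trace_conjugate:
  assumes "g \<in> unitary_group"
  shows "word_trace L (conjugate_tuple g A) = word_trace L A"
proof -
  have "word_trace L (conjugate_tuple g A) = trace (conj_transpose g ** (g ** word L A))"
    unfolding word_trace_def word_conjugate[OF assms] by (rule trace_mul_sym)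
  then show ?thesis
    using assms by (simp add: matrix_mul_assoc unitary_group_def word_trace_def)
qed

lemma continuous_on_word_trace: "continuous_on S (word_trace L)"
proof -
  have "continuous_on S (\<lambda>A. word L A $ a $ b)" for a b
  proof (induction L arbitrary: a b)
    case (Cons p L)
    obtain k u where p: "p = (k, u)" by fastforce
    have "continuous_on S (\<lambda>A. \<Sum>j\<in>UNIV. (A $ k $ a $ j - mat u $ a $ j) * word L A $ j $ b)"
      by (intro continuous_on_sum continuous_on_mult Cons) (intro continuous_intros)
    then show ?case by (simp add: p matrix_matrix_mult_def)
  qed simp
  then show ?thesis
    unfolding word_trace_def trace_def by (intro continuous_on_sum)
qed

lemma word_diag_tuple:
  "word L (diag_tuple z) $ a $ b = (if a = b then \<Prod>(k, u)\<leftarrow>L. z a $ k - u else 0)"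
proof (induction L arbitrary: a b)
  case (Cons p L)
  obtain k u where p: "p = (k, u)" by fastforce
  have "diag_tuple z $ k - mat u = diag_tuple (\<lambda>a. \<chi> i. z a $ i - u) $ k"
    by (simp add: vec_eq_iff diag_tuple_nth mat_def)
  then show ?case using Cons by (simp add: p diag_tuple_mult_left)
qed (simp add: mat_def)

lemma word_trace_diag_tuple:
  "word_trace L (diag_tuple z) = (\<Sum>a\<in>UNIV. \<Prod>(k, u)\<leftarrow>L. z a $ k - u)"
  by (simp add: word_trace_def trace_def word_diag_tuple)

text \<open>A product of linear polynomials vanishing at all the other values isolates the multiplicity
  of a given value.\<close>

lemma card_eq_of_word_trace:
  fixes z w :: "'k::finite \<Rightarrow> complex^'n"
  assumes eq: "\<And>L. word_trace L (diag_tuple z) = word_trace L (diag_tuple w)"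
  shows "card {a. z a = v} = card {a. w a = v}"
proof -
  have "\<exists>us. set us = range z \<union> range w - {v}" by (intro finite_list) simp
  then obtain us where us: "set us = range z \<union> range w - {v}" by blast
  have "\<forall>u\<in>set us. \<exists>k. v $ k \<noteq> u $ k" unfolding us by (auto simp: vec_eq_iff)
  \<comment> \<open>For each competing value \<open>u\<close> a coordinate \<open>k u\<close> where
    it differs from \<open>v\<close>: the factor for this coordinate vanishes at \<open>u\<close>
    but not at \<open>v\<close>.\<close>
  then obtain k where k: "\<And>u. u \<in> set us \<Longrightarrow> v $ k u \<noteq> u $ k u" by metis
  define L where "L = map (\<lambda>u. (k u, u $ k u)) us"
  define P where "P = (\<lambda>x. \<Prod>(i, u)\<leftarrow>L. x $ i - u)"
  have "P v \<noteq> 0" using k by (auto simp: P_def L_def prod_list_zero_iff)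
  have P0: "P x = 0" if "x \<in> set us" for x
    using that by (auto simp: P_def L_def prod_list_zero_iff image_iff)
  have sum: "word_trace L (diag_tuple y) = of_nat (card {a. y a = v}) * P v"
    if "range y \<subseteq> range z \<union> range w" for y
  proof -
    have "word_trace L (diag_tuple y) = (\<Sum>a\<in>UNIV. P (y a))"
      by (simp add: word_trace_diag_tuple P_def)
    also have "\<dots> = (\<Sum>a\<in>UNIV. if y a = v then P v else 0)"
      by (rule sum.cong) (use that P0 us in auto)
    finally have "word_trace L (diag_tuple y) = (\<Sum>a\<in>UNIV. if y a = v then P v else 0)" .
    then show ?thesis by (simp add: sum.If_cases)
  qed
  have "of_nat (card {a. z a = v}) * P v = of_nat (card {a. w a = v}) * P v"
    using eq[of L] by (simp only: sum[of z] sum[of w] Un_upper1 Un_upper2)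
  then show ?thesis using \<open>P v \<noteq> 0\<close> by simp
qed

subsection \<open>The representation spaces of the unitary and symplectic groups\<close>

lemma topspace_Hom_space [simp]: "topspace (Hom_space G) = commuting_tuples G"
  by (simp add: Hom_space_def)

text \<open>Presents the torus power as a subspace of a function type, so that continuity of maps
  out of it becomes a \<open>continuous_on\<close> statement.\<close>

lemma product_torus:
  "product_topology (\<lambda>_. torus) (UNIV :: 'm::finite set) =
    top_of_set {z :: 'm \<Rightarrow> complex^'n. \<forall>j. z j \<in> topspace torus}"
proof -
  have "{z :: 'm \<Rightarrow> complex^'n. \<forall>j. z j \<in> topspace torus} = (\<Pi>\<^sub>E j\<in>UNIV. topspace torus)"
    by (auto simp: PiE_def)
  moreover have "torus = top_of_set (topspace torus)"
    by (simp add: torus_def)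
  ultimately show ?thesis
    using subtopology_product_topology[of "\<lambda>_. euclidean" "UNIV :: 'm set" "\<lambda>_. topspace torus"]
    by (metis euclidean_product_topology)
qed

lemma continuous_map_diag_tuple:
  fixes h :: "('m::finite \<Rightarrow> complex^'n) \<Rightarrow> 'k::finite \<Rightarrow> complex^'n"
  assumes h: "\<And>a. continuous_on UNIV (\<lambda>z. h z a)"
    and G: "\<And>z. (\<And>j. z j \<in> topspace torus) \<Longrightarrow> diag_tuple (h z) \<in> commuting_tuples G"
  shows "continuous_map (product_topology (\<lambda>_. torus) UNIV) (Hom_space G) (\<lambda>z. diag_tuple (h z))"
proof -
  have "continuous_on S (\<lambda>z. if a = b then h z a $ i else 0)" for a b i S
    using continuous_on_subset[OF h] by (cases "a = b") (auto intro!: continuous_intros)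
  then have "continuous_on S (\<lambda>z. diag_tuple (h z))" for S
    unfolding diag_tuple_def by (intro continuous_on_vec_lambda)
  then show ?thesis
    using G unfolding product_torus Hom_space_def by auto
qed

context unitary_subgroup
begin

lemma continuous_map_word_trace: "continuous_map (Hom_space G) euclidean (word_trace L)"
  by (simp add: Hom_space_def continuous_on_word_trace)

lemma word_trace_conj_orbit:
  assumes "conj_orbit A = conj_orbit B"
  shows "word_trace L A = word_trace L B"
  using assms
proof (rule conj_orbit_eqD)
  fix g assume "g \<in> G" "A = conjugate_tuple g B"
  then show ?thesis using unitary word_trace_conjugate by blast
qed

end

lemma diag_tuple_commuting_unitary:
  "(\<And>j. z j \<in> topspace torus) \<Longrightarrow> diag_tuple z \<in> commuting_tuples unitary_group"
  by (simp add: commuting_tuples_def diag_tuple_unitary diag_tuple_commutes)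

lemma diag_tuple_commuting_symplectic:
  "(\<And>j. z j \<in> topspace torus) \<Longrightarrow>
    diag_tuple (quat_weights z) \<in> commuting_tuples compact_symplectic_group"
  by (simp add: commuting_tuples_def diag_tuple_symplectic diag_tuple_commutes)

lemma frame_weights_torus:
  assumes "\<And>i. A $ i \<in> unitary_group" "\<And>i j. A $ i *v f j = z j $ i *s f j" "\<And>j. hdot (f j) (f j) = 1"
  shows "z j \<in> topspace torus"
  unfolding topspace_torus using unitary_eigenvalue(1)[OF assms(1,3,2)] by blast

text \<open>Used in two ways: to diagonalise an arbitrary tuple, and, with a permuted standard basis
  as frame, to show that permuting the diagonal entries stays within an orbit.\<close>

lemma conj_orbit_unitary_frame:
  assumes "orthonormal f" "\<And>i j. A $ i *v f j = z j $ i *s f j"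
  shows "orbit (conjugate_tuple ` unitary_group) A = orbit (conjugate_tuple ` unitary_group) (diag_tuple z)"
  using unitary.conj_orbit_conjugate[OF matrix_of_columns_unitary[OF assms(1)], of "diag_tuple z"]
    conjugate_diag_tuple[of f A z] assms by simp

lemma conj_orbit_symplectic_frame:
  assumes A: "A \<in> commuting_tuples compact_symplectic_group"
    and f: "orthonormal (quat_frame f)" "\<And>i j. A $ i *v f j = z j $ i *s f j"
  shows "orbit (conjugate_tuple ` compact_symplectic_group) A =
    orbit (conjugate_tuple ` compact_symplectic_group) (diag_tuple (quat_weights z))"
proof -
  have "A $ i *v quat_frame f x = quat_weights z x $ i *s quat_frame f x" for i x
    using A f(2) by (intro quat_frame_eigenvectors) (auto simp: commuting_tuples_def)
  then have "A = conjugate_tuple (matrix_of_columns (quat_frame f)) (diag_tuple (quat_weights z))"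
    by (rule conjugate_diag_tuple[OF f(1)])
  then show ?thesis
    using symplectic.conj_orbit_conjugate[OF matrix_of_quat_frame_symplectic[OF f(1)]] by metis
qed

proposition Rep_unitary_homeomorphic:
  "(Rep_space unitary_group :: ((complex^'m^'m)^'n) set topology) homeomorphic_space
     (symmetric_product torus :: ('m::finite \<Rightarrow> complex^'n) set topology)"
  unfolding Rep_space_def symmetric_product_def
proof (rule orbit_space_homeomorphic_quotient[where \<phi> = diag_tuple and F = "range word_trace",
      OF compact_space_power[OF compact_space_torus] quotient_map_orbit])
  let ?K = "product_topology (\<lambda>_. torus) UNIV :: ('m \<Rightarrow> complex^'n) topology"
  let ?o = "orbit (conjugate_tuple ` unitary_group) :: (complex^'m^'m)^'n \<Rightarrow> _"
  let ?q = "orbit ((\<lambda>p x. x \<circ> p) ` {p. bij p}) :: ('m \<Rightarrow> complex^'n) \<Rightarrow> _"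
  show "continuous_map ?K (Hom_space unitary_group) diag_tuple"
    by (rule continuous_map_diag_tuple)
      (auto intro!: diag_tuple_commuting_unitary continuous_on_product_coordinates)
  show "\<exists>k\<in>topspace ?K. ?o (diag_tuple k) = ?o A" if "A \<in> topspace (Hom_space unitary_group)" for A
  proof -
    have A: "A \<in> commuting_tuples unitary_group" using that by simp
    obtain f z where f: "orthonormal f" "\<And>i j. A $ i *v f j = z j $ i *s f j"
      using exists_unitary_frame[OF A] by metis
    have "z j \<in> topspace torus" for j
      by (rule frame_weights_torus[of A f]) (use A f in \<open>auto simp: commuting_tuples_def orthonormal_def\<close>)
    then have "z \<in> topspace ?K" by (simp add: PiE_UNIV_domain)
    then show ?thesis using conj_orbit_unitary_frame[OF f] by metis
  qed
  show "?o (diag_tuple z) = ?o (diag_tuple w)" if q: "?q z = ?q w" for z w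
  proof -
    obtain p where p: "bij p" "z = w \<circ> p" using q orbit_reindexing_eq_iff[of z w] by blast
    \<comment> \<open>The permuted standard basis is a joint eigenframe of
      \<open>diag_tuple w\<close> whose weights, in the new order, are \<open>z\<close>.\<close>
    have "orthonormal (\<lambda>j. axis (p j) 1)"
      using p(1) by (simp add: orthonormal_def hdot_axis bij_is_inj inj_eq)
    then show ?thesis
      by (rule conj_orbit_unitary_frame[symmetric]) (simp only: diag_tuple_axis p(2) comp_apply)
  qed
  show "?q z = ?q w" if "\<forall>f\<in>range word_trace. f (diag_tuple z) = f (diag_tuple w)" for z w
  proof -
    have "card {a. z a = v} = card {a. w a = v}" for v
      by (rule card_eq_of_word_trace) (use that in blast)
    then obtain p where "bij p" "z = w \<circ> p" by (rule exists_reindexing)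
    then show ?thesis unfolding orbit_reindexing_eq_iff by blast
  qed
  show "continuous_map (Hom_space unitary_group) euclidean f" if "f \<in> range word_trace"
    for f :: "(complex^'m^'m)^'n \<Rightarrow> complex"
    using that unitary.continuous_map_word_trace by blast
  show "f A = f B" if "f \<in> range word_trace" "?o A = ?o B" for f A B
    using that unitary.word_trace_conj_orbit by blast
qed

lemma card_quat_weights:
  fixes z :: "'m::finite \<Rightarrow> complex^'n"
  shows "card {x. quat_weights z x = v} = card {j. z j = v} + card {j. z j = cnj_vec v}"
proof -
  have *: "cnj_vec u = v \<longleftrightarrow> u = cnj_vec v" for u :: "complex^'n"
    by (metis cnj_vec_cnj_vec)
  have "x \<in> {x. quat_weights z x = v} \<longleftrightarrow> x \<in> Inl ` {j. z j = v} \<union> Inr ` {j. z j = cnj_vec v}" for x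
    by (cases x) (auto simp: *)
  then have "{x. quat_weights z x = v} = Inl ` {j. z j = v} \<union> Inr ` {j. z j = cnj_vec v}"
    by blast
  moreover have "card (Inl ` {j. z j = v} \<union> Inr ` {j. z j = cnj_vec v}) =
      card {j. z j = v} + card {j. z j = cnj_vec v}"
    by (subst card_Un_disjoint) (auto simp: card_image)
  ultimately show ?thesis by simp
qed

text \<open>The doubled family takes the value v once for each index with z j = v and once for each
  with z j conjugate to v. These index sets are disjoint unless v is its own conjugate, when they
  coincide and every index is counted twice.\<close>

lemma card_conj_class:
  fixes z :: "'m::finite \<Rightarrow> complex^'n"
  shows "card {j. z j = v \<or> z j = cnj_vec v} =
    card {x. quat_weights z x = v} div (if v = cnj_vec v then 2 else 1)"
proof (cases "v = cnj_vec v")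
  case True
  then have "{j. z j = v \<or> z j = cnj_vec v} = {j. z j = v}" by auto
  then show ?thesis using True by (simp add: card_quat_weights)
next
  case False
  then have "card ({j. z j = v} \<union> {j. z j = cnj_vec v}) = card {j. z j = v} + card {j. z j = cnj_vec v}"
    by (intro card_Un_disjoint) auto
  then show ?thesis using False by (simp add: card_quat_weights Collect_disj_eq)
qed

proposition Rep_symplectic_homeomorphic:
  "(Rep_space compact_symplectic_group :: ((complex^('m::finite + 'm)^('m + 'm))^'n) set topology)
     homeomorphic_space (symmetric_product torus_mod_conj :: ('m \<Rightarrow> (complex^'n) set) set topology)"
  unfolding Rep_space_def
proof (rule orbit_space_homeomorphic_quotient[where \<phi> = "\<lambda>z. diag_tuple (quat_weights z)"
      and F = "range word_trace", OF compact_space_power[OF compact_space_torus]])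
  let ?K = "product_topology (\<lambda>_. torus) UNIV :: ('m \<Rightarrow> complex^'n) topology"
  let ?o = "orbit (conjugate_tuple ` compact_symplectic_group) ::
    (complex^('m::finite + 'm)^('m + 'm))^'n \<Rightarrow> _"
  let ?c = "orbit {id, \<lambda>z. \<chi> i. cnj (z $ i)} :: complex^'n \<Rightarrow> _"
  let ?q = "orbit ((\<lambda>p x. x \<circ> p) ` {p. bij p}) \<circ> (\<circ>) ?c :: ('m \<Rightarrow> complex^'n) \<Rightarrow> _"
  have q_eq: "?q z = ?q w \<longleftrightarrow> (\<exists>p. bij p \<and> (\<forall>j. z j = w (p j) \<or> z j = cnj_vec (w (p j))))" for z w
    by (simp add: orbit_reindexing_eq_iff fun_eq_iff orbit_cnj_eq_iff)
  have "quotient_map torus torus_mod_conj ?c"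
    unfolding torus_mod_conj_def by (rule quotient_map_orbit)
  then have "quotient_map ?K (product_topology (\<lambda>_. torus_mod_conj) UNIV) ((\<circ>) ?c)"
    by (rule quotient_map_power[OF compact_space_torus _ Hausdorff_space_torus_mod_conj])
  then show "quotient_map ?K (symmetric_product torus_mod_conj) ?q"
    unfolding symmetric_product_def by (rule quotient_map_compose) (rule quotient_map_orbit)
  show "continuous_map ?K (Hom_space compact_symplectic_group) (\<lambda>z. diag_tuple (quat_weights z))"
  proof (rule continuous_map_diag_tuple)
    show "continuous_on UNIV (\<lambda>z :: 'm \<Rightarrow> complex^'n. quat_weights z x)" for x
    proof (cases x)
      case (Inr j)
      have "continuous_on UNIV (\<lambda>z :: 'm \<Rightarrow> complex^'n. \<chi> i. cnj (z j $ i))"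
        by (intro continuous_on_vec_lambda continuous_on_cnj continuous_on_component
            continuous_on_product_coordinates)
      then show ?thesis by (simp add: Inr cnj_vec_def)
    qed (simp add: continuous_on_product_coordinates)
  qed (rule diag_tuple_commuting_symplectic)
  show "\<exists>z\<in>topspace ?K. ?o (diag_tuple (quat_weights z)) = ?o A"
    if "A \<in> topspace (Hom_space compact_symplectic_group)" for A
  proof -
    have A: "A \<in> commuting_tuples compact_symplectic_group" using that by simp
    obtain f z where f: "orthonormal (quat_frame f)" "\<And>i j. A $ i *v f j = z j $ i *s f j"
      using exists_symplectic_frame[OF A] by metis
    have "hdot (f j) (f j) = 1" for j
      using f(1) unfolding orthonormal_def by (metis quat_frame_simps(1))
    moreover have "A $ i \<in> unitary_group" for i
      using A by (simp add: commuting_tuples_def compact_symplectic_group_def)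
    ultimately have "z j \<in> topspace torus" for j
      using f(2) by (intro frame_weights_torus[of A f])
    then have "z \<in> topspace ?K" by (simp add: PiE_UNIV_domain)
    then show ?thesis using conj_orbit_symplectic_frame[OF A f] by metis
  qed
  show "?o (diag_tuple (quat_weights z)) = ?o (diag_tuple (quat_weights w))"
    if wK: "w \<in> topspace ?K" and q: "?q z = ?q w" for z w
  proof -
    obtain p where p: "bij p" "\<And>j. z j = w (p j) \<or> z j = cnj_vec (w (p j))"
      using q unfolding q_eq by blast
    \<comment> \<open>\<open>s j\<close> selects the half in which the axis vector over
      \<open>p j\<close> has weight \<open>z j\<close> rather than its conjugate;
      \<open>quat_j\<close> sends that vector, up to sign, to the axis vector of the other
      half.\<close>
    define s where "s j = (if z j = w (p j) then Inl (p j) else Inr (p j))" for j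
    have w: "diag_tuple (quat_weights w) \<in> commuting_tuples compact_symplectic_group"
      using wK by (intro diag_tuple_commuting_symplectic) (simp add: PiE_UNIV_domain Pi_iff)
    have s: "quat_weights w (s j) = z j" for j
      using p(2)[of j] by (auto simp: s_def)
    have inj: "p i = p j \<longleftrightarrow> i = j" for i j using p(1) by (simp add: bij_is_inj inj_eq)
    have "orthonormal (quat_frame (\<lambda>j. axis (s j) 1))"
      by (rule orthonormal_quat_frame)
        (auto simp: hdot_axis inj s_def quat_j_axis hdot_minus_right)
    then show ?thesis
      by (rule conj_orbit_symplectic_frame[OF w, symmetric]) (simp add: diag_tuple_axis s)
  qed
  show "?q z = ?q w"
    if "\<forall>f\<in>range word_trace. f (diag_tuple (quat_weights z)) = f (diag_tuple (quat_weights w))" for z w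
  proof -
    have eq: "card {a. quat_weights z a = v} = card {a. quat_weights w a = v}" for v
      by (rule card_eq_of_word_trace) (use that in blast)
    have "card {j. (?c \<circ> z) j = C} = card {j. (?c \<circ> w) j = C}" for C
    proof (cases "\<exists>v. C = ?c v")
      case True
      then obtain v where "C = ?c v" by blast
      then show ?thesis by (simp add: orbit_cnj_eq_iff card_conj_class eq)
    next
      case False
      then have "{j. (?c \<circ> z) j = C} = {}" "{j. (?c \<circ> w) j = C} = {}" by auto
      then show ?thesis by simp
    qed
    then obtain p where "bij p" "?c \<circ> z = ?c \<circ> w \<circ> p" by (rule exists_reindexing)
    then show ?thesis by (simp add: orbit_reindexing_eq_iff) blast
  qed
  show "continuous_map (Hom_space compact_symplectic_group) euclidean f" if "f \<in> range word_trace"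
    for f :: "(complex^('m + 'm)^('m + 'm))^'n \<Rightarrow> complex"
    using that symplectic.continuous_map_word_trace by blast
  show "f A = f B" if "f \<in> range word_trace" "?o A = ?o B" for f A B
    using that symplectic.word_trace_conj_orbit by blast
qed

subsection \<open>The determinant bundle\<close>

lemma det_conj_transpose: "det (conj_transpose A) = cnj (det A)"
proof -
  have "conj_transpose A = transpose (\<chi> i j. cnj (A $ i $ j))"
    by (simp add: conj_transpose_def transpose_def)
  then have "det (conj_transpose A) = det (\<chi> i j. cnj (A $ i $ j))"
    by (simp add: det_transpose)
  then show ?thesis by (simp add: det_def)
qed

lemma norm_det_unitary:
  assumes "g \<in> unitary_group"
  shows "norm (det g) = 1"
proof -
  have "det g * cnj (det g) = 1"
    using assms unfolding det_conj_transpose[symmetric] by (simp add: unitary_group_def flip: det_mul)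
  then have "(norm (det g))\<^sup>2 = 1"
    by (metis complex_norm_square of_real_eq_1_iff)
  then show ?thesis using norm_ge_zero[of "det g"] unfolding power2_eq_1_iff by linarith
qed

lemma conj_transpose_mat: "conj_transpose (mat c) = mat (cnj c)"
  by (simp add: conj_transpose_def mat_def vec_eq_iff)

lemma mat_mult_nth: "(mat (c :: complex) ** M) $ a $ b = c * M $ a $ b"
  by (simp add: matrix_matrix_mult_def mat_def if_distrib[of "\<lambda>x. x * _"] cong: if_cong)

lemma mat_mult_mat: "mat (c :: complex) ** mat d = mat (c * d)"
  by (simp add: vec_eq_iff mat_mult_nth) (simp add: mat_def)

lemma mat_left_commute: "M ** (mat (c :: complex) ** N) = mat c ** (M ** N)"
  using mat_commute[of c M] by (simp add: matrix_mul_assoc)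

lemma mat_unitary: "norm c = 1 \<Longrightarrow> mat c \<in> unitary_group"
  by (simp add: unitary_group_def conj_transpose_mat mat_mult_mat cnj_mult_eq_1 mult.commute)

lemma det_mat_mult: "det (mat c ** A :: complex^'k^'k) = c ^ CARD('k) * det A"
proof -
  have "det (mat c :: complex^'k^'k) = c ^ CARD('k)"
    by (subst det_diagonal) (simp_all add: mat_def)
  then show ?thesis by (simp add: det_mul)
qed

lemma conjugate_tuple_mat:
  assumes "norm c = 1"
  shows "conjugate_tuple (mat c) A = A"
proof -
  have "mat c ** A $ i ** mat (cnj c) = A $ i" for i
    unfolding mat_commute[of c "A $ i"] using cnj_mult_eq_1[OF assms]
    by (simp add: matrix_mul_assoc[symmetric] mat_mult_mat)
  then show ?thesis
    by (simp add: conjugate_tuple_def matrix_inv_unitary[OF mat_unitary[OF assms]]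
        conj_transpose_mat vec_eq_iff)
qed

lemma exists_root: "n > 0 \<Longrightarrow> w \<noteq> 0 \<Longrightarrow> \<exists>c :: complex. c ^ n = w"
  by (intro exI[of _ "exp (Ln w / of_nat n)"]) (simp flip: exp_of_nat_mult)

lemma norm_eq_1_of_power: "norm (c ^ n) = 1 \<Longrightarrow> n > 0 \<Longrightarrow> norm c = 1"
  for c :: complex
  by (metis norm_power norm_ge_zero power_eq_imp_eq_base power_one zero_le_one)

lemma conjugate_tuple_special_unitary:
  "(conjugate_tuple ` special_unitary_group :: ((complex^'k^'k)^'n \<Rightarrow> _) set) =
    conjugate_tuple ` unitary_group"
proof (rule equalityI)
  show "conjugate_tuple ` special_unitary_group \<subseteq> (conjugate_tuple ` unitary_group
      :: ((complex^'k^'k)^'n \<Rightarrow> _) set)"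
    by (rule image_mono) (auto simp: special_unitary_group_def)
  show "conjugate_tuple ` unitary_group \<subseteq> (conjugate_tuple ` special_unitary_group
      :: ((complex^'k^'k)^'n \<Rightarrow> _) set)"
  proof
    fix \<gamma> :: "(complex^'k^'k)^'n \<Rightarrow> (complex^'k^'k)^'n"
    assume "\<gamma> \<in> conjugate_tuple ` unitary_group"
    then obtain g where g: "g \<in> unitary_group" "\<gamma> = conjugate_tuple g" by blast
    have det: "norm (det g) = 1" by (rule norm_det_unitary[OF g(1)])
    then have "det g \<noteq> 0" by auto
    \<comment> \<open>Scaling \<open>g\<close> by an m-th root of the inverse determinant makes its
      determinant 1; the scalar cancels in conjugation.\<close>
    then obtain c where c: "c ^ CARD('k) = inverse (det g)"
      using exists_root[of "CARD('k)" "inverse (det g)"] by auto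
    have nc: "norm c = 1"
      by (rule norm_eq_1_of_power[of _ "CARD('k)"]) (simp_all add: c norm_inverse det)
    have "mat c ** g \<in> special_unitary_group"
      using unitary_group_mult[OF mat_unitary[OF nc] g(1)] \<open>det g \<noteq> 0\<close>
      by (simp add: special_unitary_group_def det_mat_mult c)
    moreover have "conjugate_tuple (mat c ** g) A = conjugate_tuple g A" for A :: "(complex^'k^'k)^'n"
      using conjugate_tuple_mult[OF mat_unitary[OF nc] g(1), of A]
      by (simp add: conjugate_tuple_mat[OF nc])
    then have "\<gamma> = conjugate_tuple (mat c ** g)" unfolding g(2) by (intro ext) simp
    ultimately show "\<gamma> \<in> conjugate_tuple ` special_unitary_group" by blast
  qed
qed

section \<open>Scaling by the torus and local roots\<close>

definition scale_tuple :: "complex^'n \<Rightarrow> (complex^'k^'k)^'n \<Rightarrow> (complex^'k^'k)^'n" where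
  "scale_tuple t A = (\<chi> i. mat (t $ i) ** A $ i)"

lemma scale_tuple_commuting:
  fixes A :: "(complex^'k^'k)^'n"
  assumes "t \<in> topspace torus" "A \<in> commuting_tuples unitary_group"
  shows "scale_tuple t A \<in> commuting_tuples unitary_group"
proof -
  have "mat a ** X ** (mat b ** Y) = mat (a * b) ** (X ** Y)" for a b and X Y :: "complex^'k^'k"
    unfolding matrix_mul_assoc[symmetric, of "mat a"] mat_left_commute[of X]
    by (simp only: matrix_mul_assoc mat_mult_mat)
  then show ?thesis
    using assms
    by (auto simp: commuting_tuples_def scale_tuple_def topspace_torus mult.commute
        intro!: unitary_group_mult mat_unitary)
qed

lemma det_scale_tuple:
  "det_tuple (scale_tuple t A :: (complex^'k^'k)^'n) $ i = t $ i ^ CARD('k) * det_tuple A $ i"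
  by (simp add: det_tuple_def scale_tuple_def det_mat_mult)

lemma conjugate_scale_tuple: "conjugate_tuple g (scale_tuple t A) = scale_tuple t (conjugate_tuple g A)"
  unfolding conjugate_tuple_def scale_tuple_def
  by (simp add: mat_left_commute flip: matrix_mul_assoc)

text \<open>Scalar matrices commute with conjugation. Writing the induced action on orbits as an
  image of sets avoids any choice of representatives.\<close>

lemma orbit_scale_tuple:
  "orbit (conjugate_tuple ` G) (scale_tuple t A) = scale_tuple t ` orbit (conjugate_tuple ` G) A"
  by (simp add: orbit_def image_image conjugate_scale_tuple)

lemma scale_tuple_cnj_vec:
  assumes "t \<in> topspace torus"
  shows "scale_tuple (cnj_vec t) (scale_tuple t A) = A" "scale_tuple t (scale_tuple (cnj_vec t) A) = A"
  using assms cnj_mult_eq_1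
  by (simp_all add: scale_tuple_def vec_eq_iff mat_mult_nth topspace_torus mult.commute flip: mult.assoc)

lemma cnj_vec_torus: "t \<in> topspace torus \<Longrightarrow> cnj_vec t \<in> topspace torus"
  by (simp add: topspace_torus)

lemma continuous_on_scale_tuple:
  assumes "continuous_on S t" "continuous_on S A"
  shows "continuous_on S (\<lambda>x. scale_tuple (t x) (A x))"
proof -
  have "scale_tuple s B = (\<chi> i a b. s $ i * B $ i $ a $ b)" for s and B :: "(complex^'c^'c)^'b"
    by (simp add: scale_tuple_def vec_eq_iff mat_mult_nth)
  then show ?thesis
    using assms by (auto intro!: continuous_on_vec_lambda continuous_on_mult continuous_on_component)
qed

lemma continuous_on_det_tuple: "continuous_on S det_tuple"
  unfolding det_tuple_def det_def
  by (intro continuous_on_vec_lambda continuous_on_sum continuous_on_mult continuous_on_prod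
      continuous_on_component continuous_on_const continuous_on_id)

lemma det_tuple_torus: "A \<in> commuting_tuples unitary_group \<Longrightarrow> det_tuple A \<in> topspace torus"
  by (simp add: topspace_torus det_tuple_def commuting_tuples_def norm_det_unitary)

lemma commuting_special_unitary:
  "commuting_tuples special_unitary_group =
    {A \<in> commuting_tuples unitary_group. det_tuple A = (\<chi> i. 1)}"
  by (auto simp: commuting_tuples_def special_unitary_group_def det_tuple_def vec_eq_iff)

lemma torus_eq_top_of_set: "torus = top_of_set (topspace torus)"
  by (simp add: torus_def)

lemma subtopology_eq_top_of_set:
  assumes "X = top_of_set (topspace X)" "S \<subseteq> topspace X"
  shows "subtopology X S = top_of_set S"
  using assms subtopology_subtopology[of euclidean "topspace X" S] by (simp add: inf_absorb2)

text \<open>Dividing by \<open>b\<close> moves the base point to 1, where the principal logarithm is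
  continuous off the closed negative half-line. This gives roots of u / b near 1 in each coordinate,
  and a fixed root \<open>r\<close> of \<open>b\<close> moves them back.\<close>

lemma torus_root_section:
  assumes b: "b \<in> topspace torus" and n: "n > 0"
  obtains U s where "openin torus U" "b \<in> U" "continuous_map (subtopology torus U) torus s"
    "\<And>u i. u \<in> U \<Longrightarrow> s u $ i ^ n = u $ i"
proof -
  have b0: "b $ i \<noteq> 0" for i using b unfolding topspace_torus by (metis norm_zero zero_neq_one)
  define V where "V = {u. \<forall>i. u $ i / b $ i \<notin> \<real>\<^sub>\<le>\<^sub>0}"
  define U where "U = topspace torus \<inter> V"
  have "\<exists>r. \<forall>i. r i ^ n = b $ i" using exists_root[OF n b0] by metis
  then obtain r where r: "\<And>i. r i ^ n = b $ i" by blast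
  define s where "s = (\<lambda>u :: complex^'a. \<chi> i. r i * exp (Ln (u $ i / b $ i) / of_nat n))"
  have "V = (\<Inter>i. (\<lambda>u. u $ i / b $ i) -` (- \<real>\<^sub>\<le>\<^sub>0))" by (auto simp: V_def)
  moreover have "open ((\<lambda>u. u $ i / b $ i) -` (- \<real>\<^sub>\<le>\<^sub>0))" for i
    by (intro open_vimage open_Compl closed_nonpos_Reals_complex continuous_on_divide
        continuous_on_component continuous_on_id continuous_on_const) (simp add: b0)
  ultimately have "open V" by (simp add: open_INT)
  then have "openin torus U"
    unfolding U_def torus_def by (simp add: openin_open_Int)
  moreover have "b \<in> U" using b b0 by (simp add: U_def V_def)
  moreover have root: "s u $ i ^ n = u $ i" if "u \<in> U" for u i
  proof -
    have "u $ i \<noteq> 0" using that unfolding U_def topspace_torus Int_iff by (metis norm_zero zero_neq_one)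
    then have "exp (Ln (u $ i / b $ i) / of_nat n) ^ n = u $ i / b $ i"
      using n b0 by (simp flip: exp_of_nat_mult)
    then show ?thesis using b0 by (simp add: s_def power_mult_distrib r)
  qed
  moreover have "continuous_map (subtopology torus U) torus s"
  proof -
    have "continuous_on U s"
      unfolding s_def using n b0
      by (intro continuous_on_vec_lambda continuous_intros) (auto simp: U_def V_def)
    moreover have "s u \<in> topspace torus" if "u \<in> U" for u
      unfolding topspace_torus
    proof
      fix i
      have "norm (u $ i) = 1" using that by (simp add: U_def topspace_torus)
      then show "norm (s u $ i) = 1"
        using norm_eq_1_of_power[of "s u $ i" n] n root[OF that, of i] by simp
    qed
    ultimately have "continuous_map (top_of_set U) (top_of_set (topspace torus)) s"
      by auto
    moreover have "subtopology torus U = top_of_set U"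
      by (rule subtopology_eq_top_of_set[OF torus_eq_top_of_set]) (auto simp: U_def)
    ultimately show ?thesis by (simp add: torus_eq_top_of_set[symmetric])
  qed
  ultimately show thesis using that by blast
qed

proposition Rep_det_bundle:
  "locally_trivial_bundle
     (Rep_space special_unitary_group :: ((complex^'m^'m)^'n) set topology)
     (Rep_incl unitary_group)
     (Rep_space unitary_group) Rep_det torus (\<chi> i. 1)"
proof -
  define \<Gamma> :: "((complex^'m^'m)^'n \<Rightarrow> _) set" where "\<Gamma> = conjugate_tuple ` unitary_group"
  define H :: "((complex^'m^'m)^'n) topology" where "H = Hom_space unitary_group"
  define H1 :: "((complex^'m^'m)^'n) topology" where "H1 = Hom_space special_unitary_group"
  define E where "E = orbit_space H \<Gamma>"
  define F where "F = orbit_space H1 \<Gamma>"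
  let ?one = "\<chi> i. 1 :: complex^'n"
  have E: "Rep_space unitary_group = E" and F: "Rep_space special_unitary_group = F"
    by (simp_all add: E_def F_def H_def H1_def \<Gamma>_def Rep_space_def conjugate_tuple_special_unitary)
  have qE: "quotient_map H E (orbit \<Gamma>)" and qF: "quotient_map H1 F (orbit \<Gamma>)"
    by (simp_all add: E_def F_def quotient_map_orbit)
  have topE: "topspace E = orbit \<Gamma> ` topspace H" and topF: "topspace F = orbit \<Gamma> ` topspace H1"
    by (simp_all add: E_def F_def topspace_orbit_space)
  have det: "Rep_det (orbit \<Gamma> A) = det_tuple A" for A
    by (simp add: \<Gamma>_def Rep_det_orbit)
  have scale: "orbit \<Gamma> (scale_tuple t A) = scale_tuple t ` orbit \<Gamma> A" for t A
    by (simp add: \<Gamma>_def orbit_scale_tuple)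
  have H1: "A \<in> topspace H1 \<longleftrightarrow> A \<in> topspace H \<and> det_tuple A = ?one" for A
    by (simp add: H_def H1_def commuting_special_unitary)
  have detT: "det_tuple A \<in> topspace torus" if "A \<in> topspace H" for A
    using that by (simp add: H_def det_tuple_torus)
  have scaleH: "scale_tuple t A \<in> topspace H" if "t \<in> topspace torus" "A \<in> topspace H" for t A
    using that by (simp add: H_def scale_tuple_commuting)
  have H_top: "H = top_of_set (topspace H)" and H1_top: "H1 = top_of_set (topspace H1)"
    by (simp_all add: H_def H1_def Hom_space_def)
  have H1_sub: "subtopology H (topspace H1) = H1"
    by (subst H1_top, rule subtopology_eq_top_of_set[OF H_top]) (auto simp: H1)

  have "continuous_map H torus det_tuple"
    using detT by (subst H_top, subst torus_eq_top_of_set) (auto simp: continuous_on_det_tuple)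
  then have cdet: "continuous_map E torus Rep_det"
    by (intro continuous_compose_quotient_map[OF qE]) (simp add: comp_def det)

  have det_onto: "Rep_det ` topspace E = topspace torus"
  proof (intro equalityI subsetI)
    fix t :: "complex^'n" assume t: "t \<in> topspace torus"
    obtain a :: 'm where True by blast
    \<comment> \<open>All of \<open>t\<close> goes into a single diagonal position and 1 into the
      others, so the determinant is \<open>t\<close> itself.\<close>
    define z where "z = (\<lambda>b :: 'm. if b = a then t else ?one)"
    have "z b \<in> topspace torus" for b using t by (simp add: z_def topspace_torus)
    then have "diag_tuple z \<in> topspace H" by (simp add: H_def diag_tuple_commuting_unitary)
    moreover have "det_tuple (diag_tuple z) = t"
    proof -
      have "det (diag_tuple z $ i) = (\<Prod>b\<in>UNIV. z b $ i)" for i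
        by (subst det_diagonal) (simp_all add: diag_tuple_nth)
      moreover have "(\<Prod>b\<in>UNIV. z b $ i) = (\<Prod>b\<in>UNIV. if b = a then t $ i else 1)" for i
        by (rule prod.cong) (simp_all add: z_def)
      ultimately show ?thesis by (simp add: det_tuple_def vec_eq_iff)
    qed
    ultimately show "t \<in> Rep_det ` topspace E"
      unfolding topE image_image det by (metis image_eqI)
  qed (use cdet in \<open>auto simp: continuous_map_def\<close>)

  have one: "?one \<in> topspace torus" by (simp add: topspace_torus)
  let ?fib = "{x \<in> topspace E. Rep_det x = ?one}"
  \<comment> \<open>Over a closed subset the orbit map restricts to a quotient map, so the fibre
    carries the topology of \<open>F\<close> and not merely its points.\<close>
  have "closedin torus {?one}"
    using closedin_t1_singleton[OF Hausdorff_imp_t1_space[OF Hausdorff_space_torus] one] .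
  then have "closedin E {x \<in> topspace E. Rep_det x \<in> {?one}}"
    by (rule closedin_continuous_map_preimage[OF cdet])
  then have "closedin E ?fib" by simp
  moreover have "{A \<in> topspace H. orbit \<Gamma> A \<in> ?fib} = topspace H1"
    by (auto simp: H1 topE det)
  ultimately have "quotient_map (subtopology H (topspace H1)) (subtopology E ?fib) (orbit \<Gamma>)"
    by (intro quotient_map_restriction[OF qE] disjI2)
  then have fibre: "subtopology E ?fib = F"
    unfolding H1_sub using qF by (rule quotient_topology_unique)
  \<comment> \<open>Both groups have the same orbits, so the map induced by the inclusion fixes
    every point of \<open>F\<close>.\<close>
  have incl: "Rep_incl unitary_group x = x" if x: "x \<in> topspace F" for x :: "((complex^'m^'m)^'n) set"
  proof -
    obtain A where "x = orbit (conjugate_tuple ` special_unitary_group) A"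
      using x unfolding topF \<Gamma>_def conjugate_tuple_special_unitary by blast
    then show ?thesis
      using Rep_incl_orbit[of A] by (simp add: conjugate_tuple_special_unitary)
  qed
  have "homeomorphic_map F F (Rep_incl unitary_group)"
    by (rule homeomorphic_map_eq[OF homeomorphic_map_id[THEN iffD2]]) (simp_all add: incl)

  \<comment> \<open>As the torus is locally compact and Hausdorff, its product with the orbit map is
    again a quotient map, and continuity can be tested on tuples.\<close>
  have action: "continuous_map (prod_topology torus F) E (\<lambda>(t, y). scale_tuple t ` y)"
  proof (rule continuous_compose_quotient_map)
    show "quotient_map (prod_topology torus H1) (prod_topology torus F) (\<lambda>(t, A). (t, orbit \<Gamma> A))"
      by (rule quotient_map_prod_right[OF _ _ qF])
        (simp_all add: Hausdorff_space_torus compact_imp_locally_compact_space compact_space_torus)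
    have "continuous_map (prod_topology torus H1) H (\<lambda>(t, A). scale_tuple t A)"
    proof -
      have "continuous_on S (\<lambda>x. scale_tuple (fst x) (snd x))" for S :: "((complex^'n) \<times> ((complex^'m^'m)^'n)) set"
        by (intro continuous_on_scale_tuple continuous_on_fst continuous_on_snd continuous_on_id)
      moreover have "scale_tuple (fst x) (snd x) \<in> topspace H"
        if "x \<in> topspace torus \<times> topspace H1" for x
        using that scaleH H1 by auto
      ultimately have "continuous_map (top_of_set (topspace torus \<times> topspace H1)) (top_of_set (topspace H))
          (\<lambda>x. scale_tuple (fst x) (snd x))"
        by auto
      moreover have "prod_topology (torus :: (complex^'n) topology) H1 = top_of_set (topspace torus \<times> topspace H1)"
        by (metis H1_top prod_topology_subtopology_eu torus_eq_top_of_set)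
      ultimately show ?thesis
        by (simp add: H_top[symmetric] case_prod_unfold)
    qed
    then have "continuous_map (prod_topology torus H1) E (orbit \<Gamma> \<circ> (\<lambda>(t, A). scale_tuple t A))"
      by (rule continuous_map_compose[OF _ quotient_imp_continuous_map[OF qE]])
    then show "continuous_map (prod_topology torus H1) E
        ((\<lambda>(t, y). scale_tuple t ` y) \<circ> (\<lambda>(t, A). (t, orbit \<Gamma> A)))"
      by (simp add: comp_def case_prod_unfold scale)
  qed

  have "\<exists>U h. openin torus U \<and> b \<in> U \<and>
      homeomorphic_map (subtopology E {x \<in> topspace E. Rep_det x \<in> U})
        (prod_topology (subtopology torus U) F) h \<and>
      (\<forall>x \<in> topspace E. Rep_det x \<in> U \<longrightarrow> fst (h x) = Rep_det x)"
    if b: "b \<in> topspace torus" for b :: "complex^'n"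
  proof -
    obtain U s where U: "openin torus U" "b \<in> U" and s: "continuous_map (subtopology torus U) torus s"
      and root: "\<And>u i. u \<in> U \<Longrightarrow> s u $ i ^ CARD('m) = u $ i"
      using torus_root_section[OF b, of "CARD('m)"] by auto
    have UT: "U \<subseteq> topspace torus" using U(1) by (rule openin_subset)
    have sT: "s u \<in> topspace torus" if "u \<in> U" for u
      using s that UT by (auto simp: continuous_map_def)
    let ?EU = "{x \<in> topspace E. Rep_det x \<in> U}"
    let ?HU = "{A \<in> topspace H. det_tuple A \<in> U}"
    \<comment> \<open>\<open>h\<close> divides a tuple by the chosen root of its determinant, which
      brings it into SU(m), and records the determinant; \<open>k\<close> multiplies the root back
      in. On the torus \<open>cnj_vec\<close> is the inverse.\<close>
    define h where "h = (\<lambda>x :: ((complex^'m^'m)^'n) set.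
      (Rep_det x, scale_tuple (cnj_vec (s (Rep_det x))) ` x))"
    define k where "k = (\<lambda>(u, y). scale_tuple (s u) ` y :: ((complex^'m^'m)^'n) set)"
    have s_one: "det_tuple (scale_tuple (cnj_vec (s u)) A) = ?one"
      if "u \<in> U" "det_tuple A = u" for u and A :: "(complex^'m^'m)^'n"
    proof -
      have "cnj (u $ i) * u $ i = 1" for i
        using that UT cnj_mult_eq_1 by (auto simp: topspace_torus mult.commute)
      then show ?thesis
        by (simp add: vec_eq_iff det_scale_tuple that root flip: complex_cnj_power)
    qed
    have det_s: "det_tuple (scale_tuple (s u) A) = u" if "u \<in> U" "det_tuple A = ?one"
      for u and A :: "(complex^'m^'m)^'n"
      using that by (simp add: vec_eq_iff det_scale_tuple root)
    have normalize: "scale_tuple (cnj_vec (s (det_tuple A))) A \<in> topspace H1" if "A \<in> ?HU" for A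
      using that scaleH cnj_vec_torus sT s_one by (auto simp: H1)
    have h_orbit: "h (orbit \<Gamma> A) = (det_tuple A, orbit \<Gamma> (scale_tuple (cnj_vec (s (det_tuple A))) A))" for A
      by (simp add: h_def det scale)

    \<comment> \<open>Over an open set the orbit map also stays a quotient map, so continuity of
      \<open>h\<close> reduces to a statement about tuples.\<close>
    have "openin E ?EU" by (rule openin_continuous_map_preimage[OF cdet U(1)])
    moreover have "{A \<in> topspace H. orbit \<Gamma> A \<in> ?EU} = ?HU"
      by (auto simp: topE det)
    ultimately have qU: "quotient_map (subtopology H ?HU) (subtopology E ?EU) (orbit \<Gamma>)"
      by (intro quotient_map_restriction[OF qE] disjI1)
    have HU: "subtopology H ?HU = top_of_set ?HU"
      by (rule subtopology_eq_top_of_set[OF H_top]) auto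
    have UU: "subtopology torus U = top_of_set U"
      by (rule subtopology_eq_top_of_set[OF torus_eq_top_of_set UT])
    have s_cont: "continuous_on U s"
    proof -
      have "continuous_map (top_of_set U) (top_of_set (topspace torus)) s"
        using s unfolding UU torus_eq_top_of_set[symmetric] .
      then show ?thesis by auto
    qed
    have "continuous_map (subtopology E ?EU) (prod_topology (subtopology torus U) F) h"
    proof (rule continuous_compose_quotient_map[OF qU])
      have "continuous_map (top_of_set ?HU) (top_of_set U) det_tuple"
        by (auto simp: continuous_on_det_tuple)
      moreover have "continuous_map (top_of_set ?HU) F
          (orbit \<Gamma> \<circ> (\<lambda>A. scale_tuple (cnj_vec (s (det_tuple A))) A))"
      proof (rule continuous_map_compose[OF _ quotient_imp_continuous_map[OF qF]])
        have "continuous_on ?HU (\<lambda>A. s (det_tuple A))"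
          by (rule continuous_on_compose2[OF s_cont continuous_on_det_tuple]) auto
        then have "continuous_on ?HU (\<lambda>A. scale_tuple (cnj_vec (s (det_tuple A))) A)"
          unfolding cnj_vec_def
          by (intro continuous_on_scale_tuple continuous_on_vec_lambda continuous_on_cnj
              continuous_on_component continuous_on_id)
        then have "continuous_map (top_of_set ?HU) (top_of_set (topspace H1))
            (\<lambda>A. scale_tuple (cnj_vec (s (det_tuple A))) A)"
          using normalize by auto
        then show "continuous_map (top_of_set ?HU) H1 (\<lambda>A. scale_tuple (cnj_vec (s (det_tuple A))) A)"
          unfolding H1_top[symmetric] .
      qed
      ultimately show "continuous_map (subtopology H ?HU) (prod_topology (subtopology torus U) F)
          (h \<circ> orbit \<Gamma>)"
        unfolding HU UU by (simp add: continuous_map_pairwise comp_def h_orbit)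
    qed
    moreover have "continuous_map (prod_topology (subtopology torus U) F) (subtopology E ?EU) k"
    proof -
      have "continuous_map (prod_topology (subtopology torus U) F) (prod_topology torus F)
          (\<lambda>x. (s (fst x), snd x))"
        unfolding continuous_map_paired
        using continuous_map_compose[OF continuous_map_fst s] by (simp add: comp_def continuous_map_snd)
      then have "continuous_map (prod_topology (subtopology torus U) F) E
          ((\<lambda>(t, y). scale_tuple t ` y) \<circ> (\<lambda>x. (s (fst x), snd x)))"
        using action by (rule continuous_map_compose)
      then have "continuous_map (prod_topology (subtopology torus U) F) E k"
        by (simp add: comp_def k_def case_prod_unfold)
      moreover have "k (u, y) \<in> ?EU" if uy: "u \<in> U" "y \<in> topspace F" for u y
      proof -
        obtain A where A: "A \<in> topspace H1" "y = orbit \<Gamma> A" using uy(2) topF by blast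
        then have "k (u, y) = orbit \<Gamma> (scale_tuple (s u) A)" by (simp add: k_def scale)
        moreover have "scale_tuple (s u) A \<in> topspace H" using A H1 scaleH sT uy(1) by blast
        moreover have "det_tuple (scale_tuple (s u) A) = u" using A H1 det_s uy(1) by blast
        ultimately show ?thesis using uy(1) by (simp add: topE det)
      qed
      ultimately show ?thesis
        by (auto simp: continuous_map_in_subtopology)
    qed
    moreover have "k (h x) = x" if "x \<in> ?EU" for x
    proof -
      obtain A where A: "A \<in> topspace H" "x = orbit \<Gamma> A" using \<open>x \<in> ?EU\<close> topE by blast
      then have "det_tuple A \<in> U" using that det by simp
      then show ?thesis
        unfolding A(2) h_orbit k_def by (simp add: scale[symmetric] scale_tuple_cnj_vec sT)
    qed
    moreover have "h (k (u, y)) = (u, y)" if uy: "u \<in> U" "y \<in> topspace F" for u y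
    proof -
      obtain A where A: "A \<in> topspace H1" "y = orbit \<Gamma> A" using uy(2) topF by blast
      then have "det_tuple (scale_tuple (s u) A) = u" using H1 det_s uy(1) by blast
      moreover have "k (u, y) = orbit \<Gamma> (scale_tuple (s u) A)" using A by (simp add: k_def scale)
      ultimately show ?thesis by (simp add: h_orbit scale_tuple_cnj_vec sT uy(1) A(2))
    qed
    ultimately have "homeomorphic_maps (subtopology E ?EU) (prod_topology (subtopology torus U) F) h k"
      unfolding homeomorphic_maps_def by auto
    then have "homeomorphic_map (subtopology E ?EU) (prod_topology (subtopology torus U) F) h"
      using homeomorphic_map_maps by blast
    moreover have "fst (h x) = Rep_det x" for x by (simp add: h_def)
    ultimately show ?thesis using U by blast
  qed
  then show ?thesis
    unfolding locally_trivial_bundle_def E F fibre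
    using cdet det_onto one \<open>homeomorphic_map F F (Rep_incl unitary_group)\<close> by blast
qed

theorem proposition1p4:
  shows "(Rep_space unitary_group :: ((complex^'m^'m)^'n) set topology) homeomorphic_space
           (symmetric_product torus :: ('m::finite \<Rightarrow> complex^'n::finite) set topology)
       \<and> (Rep_space compact_symplectic_group :: ((complex^('m::finite + 'm)^('m + 'm))^'n) set topology)
           homeomorphic_space
           (symmetric_product torus_mod_conj :: ('m \<Rightarrow> (complex^'n) set) set topology)
       \<and> locally_trivial_bundle
           (Rep_space special_unitary_group :: ((complex^'m^'m)^'n) set topology)
           (Rep_incl unitary_group)
           (Rep_space unitary_group :: ((complex^'m^'m)^'n) set topology)
           Rep_det
           (torus :: (complex^'n) topology)
           (\<chi> i. 1)"
  using Rep_unitary_homeomorphic Rep_symplectic_homeomorphic Rep_det_bundle by blast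

end
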